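(* Let $K_1\subset\mathbb{R}^k$ and $K_2,K_3\subset\mathbb{R}^d$ be compact. Let $\nu$ be a Borel probability measure on $K_1\times K_2$ whose first marginal $m$ is centered, $\int_{K_1}\tilde x\,m(d\tilde x)=0$, and let $\mu$ be a Borel probability measure on $K_3$. Let $MI(\mu,\nu)$ be the set of Borel probability measures $\theta$ on $K_1\times K_2\times K_3$ whose $(\tilde x,y)$-marginal is $\nu$, whose $u$-marginal is $\mu$, and such that $\int v(u)^\top\tilde x\,\theta(d\tilde x,dy,du)=0$ for all $v\in C(K_3,\mathbb{R}^k)$. Then $$\max_{\theta\in MI(\mu,\nu)}\int u^\top y\,\theta(d\tilde x,dy,du)=\inf\Big\{\int_{K_1\times K_2}\psi\,d\nu+\int_{K_3}\varphi\,d\mu\Big\},$$ where the infimum is over $(\psi,\varphi,v)\in C(K_1\times K_2)\times C(K_3)\times C(K_3,\mathbb{R}^k)$ satisfying $\psi(\tilde x,y)+\varphi(u)+v(u)^\top\tilde x\ge u^\top y$ for all $(\tilde x,y,u)\in K_1\times K_2\times K_3$ (and the maximum is attained). This common value also equals the infimum of the same objective over $(\psi,\varphi,v)\in L^1(\nu)\times L^1(\mu)\times L^1(\mu,\mathbb{R}^k)$ satisfying the same constraint. *)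

theory Defs
  imports "HOL-Probability.Probability"
begin

definition borel_prob_on :: "'a::topological_space set \<Rightarrow> 'a measure \<Rightarrow> bool" where
  "borel_prob_on K M \<longleftrightarrow> prob_space M \<and> sets M = sets (restrict_space borel K)"

definition MI ::
  "(real^'k) set \<Rightarrow> (real^'d) set \<Rightarrow> (real^'d) set \<Rightarrow>
   (real^'d) measure \<Rightarrow> ((real^'k) \<times> (real^'d)) measure \<Rightarrow>
   (((real^'k) \<times> (real^'d)) \<times> (real^'d)) measure set" where
  "MI K1 K2 K3 \<mu> \<nu> =
    {\<theta>. borel_prob_on ((K1 \<times> K2) \<times> K3) \<theta>
       \<and> distr \<theta> (restrict_space borel (K1 \<times> K2)) fst = \<nu>
       \<and> distr \<theta> (restrict_space borel K3) snd = \<mu>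
       \<and> (\<forall>v :: real^'d \<Rightarrow> real^'k. continuous_on K3 v \<longrightarrow>
             (\<integral>z. v (snd z) \<bullet> fst (fst z) \<partial>\<theta>) = 0)}"

definition MI_obj :: "(((real^'k) \<times> (real^'d)) \<times> (real^'d)) measure \<Rightarrow> real" where
  "MI_obj \<theta> = (\<integral>z. snd z \<bullet> snd (fst z) \<partial>\<theta>)"

definition dual_feasible ::
  "(real^'k) set \<Rightarrow> (real^'d) set \<Rightarrow> (real^'d) set \<Rightarrow>
   ((real^'k) \<times> (real^'d) \<Rightarrow> real) \<Rightarrow> (real^'d \<Rightarrow> real) \<Rightarrow> (real^'d \<Rightarrow> real^'k) \<Rightarrow> bool" where
  "dual_feasible K1 K2 K3 \<psi> \<phi> v \<longleftrightarrow>
     (\<forall>x\<in>K1. \<forall>y\<in>K2. \<forall>u\<in>K3. \<psi> (x, y) + \<phi> u + v u \<bullet> x \<ge> u \<bullet> y)"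

end

theory Submission
  imports Defs
begin

text \<open>
  For a bounded, not necessarily continuous, function \<open>f\<close> on \<open>K = (K1 \<times> K2) \<times> K3\<close> let \<open>p f\<close> be
  the infimum of \<open>\<integral> \<psi> d\<nu> + \<integral> \<phi> d\<mu>\<close> over continuous \<open>(\<psi>, \<phi>, v)\<close> with
  \<open>\<psi> + \<phi> + v \<bullet> x \<ge> f\<close> on \<open>K\<close>. It is sublinear, and finite because \<open>\<nu>\<close> is centered. By Hahn-Banach
  there is a linear \<open>L \<le> p\<close> which agrees with \<open>p\<close> at the objective \<open>u \<bullet> y\<close>; then \<open>L\<close> is positive
  and satisfies the constraints defining \<open>MI\<close>. Since \<open>L\<close> lives on all bounded functions, it is a
  finitely additive measure on all subsets of \<open>K\<close>. This measure is countably additive on the algebra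
  of sets that it approximates by compact sets from inside and by open sets from outside; the
  Caratheodory extension is a Borel measure which represents \<open>L\<close> on continuous functions, and this is
  the optimizer. Integrable dual competitors are covered by weak duality, as the orthogonality
  relation in \<open>MI\<close> extends from continuous to integrable \<open>v\<close>.
\<close>

section \<open>Hahn-Banach for bounded functions\<close>

definition sublinear :: "('v::real_vector \<Rightarrow> real) \<Rightarrow> bool" where
  "sublinear p \<longleftrightarrow> (\<forall>x y. p (x + y) \<le> p x + p y) \<and> (\<forall>c>0. \<forall>x. p (c *\<^sub>R x) \<le> c * p x)"

lemma sublinear_add: "sublinear p \<Longrightarrow> p (x + y) \<le> p x + p y"
  by (simp add: sublinear_def)

lemma sublinear_zero:
  assumes "sublinear p"
  shows "p 0 = 0"
proof -
  \<comment> \<open>The factor 2 gives \<open>0 \<le> p 0\<close> and the factor 1/2 gives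
    \<open>p 0 \<le> 0\<close>.\<close>
  have "p (2 *\<^sub>R 0) \<le> 2 * p 0" "p ((1/2) *\<^sub>R 0) \<le> 1/2 * p 0"
    using assms unfolding sublinear_def by (metis zero_less_numeral, metis half_gt_zero zero_less_one)
  then show ?thesis
    by simp
qed

lemma sublinear_scale:
  assumes "sublinear p" "c \<ge> 0"
  shows "p (c *\<^sub>R x) = c * p x"
proof (cases "c = 0")
  case True
  then show ?thesis using sublinear_zero[OF assms(1)] by simp
next
  case False
  then have c: "c > 0" using assms by simp
  have "p (c *\<^sub>R x) \<le> c * p x"
    using assms c unfolding sublinear_def by blast
  moreover have "p (inverse c *\<^sub>R (c *\<^sub>R x)) \<le> inverse c * p (c *\<^sub>R x)"
    using assms c unfolding sublinear_def by (metis positive_imp_inverse_positive)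
  ultimately show ?thesis
    using c by (simp add: field_simps)
qed

lemma sublinear_neg_le:
  assumes "sublinear p"
  shows "- p (- x) \<le> p x"
  using sublinear_add[OF assms, of x "- x"] sublinear_zero[OF assms] by simp

text \<open>The largest sublinear minorant of \<open>p\<close> that takes the value \<open>- p a\<close> at \<open>- a\<close>.\<close>
definition linear_along :: "('v::real_vector \<Rightarrow> real) \<Rightarrow> 'v \<Rightarrow> 'v \<Rightarrow> real" where
  "linear_along p a x = (INF t\<in>{0..}. p (x + t *\<^sub>R a) - t * p a)"

lemma linear_along_le:
  assumes p: "sublinear p" and t: "0 \<le> t"
  shows "linear_along p a x \<le> p (x + t *\<^sub>R a) - t * p a"
proof -
  \<comment> \<open>A lower bound independent of \<open>s\<close>; without one, \<open>INF\<close>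
    over the reals says nothing.\<close>
  have "- p (- x) \<le> p (x + s *\<^sub>R a) - s * p a" if "0 \<le> s" for s
    using sublinear_add[OF p, of "x + s *\<^sub>R a" "- x"] sublinear_scale[OF p that, of a] by simp
  then have "bdd_below ((\<lambda>s. p (x + s *\<^sub>R a) - s * p a) ` {0..})"
    by (intro bdd_belowI2[where m = "- p (- x)"]) auto
  then show ?thesis
    unfolding linear_along_def using t by (intro cINF_lower) auto
qed

lemma linear_along_greatest:
  assumes "\<And>t. 0 \<le> t \<Longrightarrow> b \<le> p (x + t *\<^sub>R a) - t * p a"
  shows "b \<le> linear_along p a x"
  unfolding linear_along_def using assms by (intro cINF_greatest) auto

lemma linear_along_le_self: "sublinear p \<Longrightarrow> linear_along p a x \<le> p x"
  using linear_along_le[of p 0 a x] by simp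

lemma sublinear_linear_along:
  assumes p: "sublinear p"
  shows "sublinear (linear_along p a)"
  unfolding sublinear_def
proof (intro conjI allI impI)
  fix x y
  \<comment> \<open>The parameter used for \<open>x + y\<close> is \<open>s + t\<close>. Since
    \<open>s\<close> and \<open>t\<close> vary independently, the two infima can be taken one after
    the other.\<close>
  have *: "linear_along p a (x + y) \<le> (p (x + s *\<^sub>R a) - s * p a) + (p (y + t *\<^sub>R a) - t * p a)"
    if "0 \<le> s" "0 \<le> t" for s t
  proof -
    have "linear_along p a (x + y) \<le> p ((x + y) + (s + t) *\<^sub>R a) - (s + t) * p a"
      using that by (intro linear_along_le p) auto
    also have "(x + y) + (s + t) *\<^sub>R a = (x + s *\<^sub>R a) + (y + t *\<^sub>R a)"
      by (simp add: algebra_simps)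
    also have "p \<dots> \<le> p (x + s *\<^sub>R a) + p (y + t *\<^sub>R a)"
      by (rule sublinear_add[OF p])
    finally show ?thesis
      by (simp add: algebra_simps)
  qed
  have "linear_along p a (x + y) - (p (x + s *\<^sub>R a) - s * p a) \<le> linear_along p a y" if "0 \<le> s" for s
    using *[OF that] by (intro linear_along_greatest) (simp add: diff_le_eq add.commute)
  then have "linear_along p a (x + y) - linear_along p a y \<le> linear_along p a x"
    by (intro linear_along_greatest) (simp add: algebra_simps)
  then show "linear_along p a (x + y) \<le> linear_along p a x + linear_along p a y"
    by simp
next
  fix c :: real and x
  assume c: "0 < c"
  have "linear_along p a (c *\<^sub>R x) / c \<le> linear_along p a x"
  proof (rule linear_along_greatest)
    fix t :: real
    assume t: "0 \<le> t"
    have "linear_along p a (c *\<^sub>R x) \<le> p (c *\<^sub>R x + (c * t) *\<^sub>R a) - (c * t) * p a"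
      using c t by (intro linear_along_le p) auto
    also have "c *\<^sub>R x + (c * t) *\<^sub>R a = c *\<^sub>R (x + t *\<^sub>R a)"
      by (simp add: algebra_simps)
    also have "p \<dots> = c * p (x + t *\<^sub>R a)"
      using c by (intro sublinear_scale p) auto
    finally show "linear_along p a (c *\<^sub>R x) / c \<le> p (x + t *\<^sub>R a) - t * p a"
      using c by (simp add: field_simps)
  qed
  then show "linear_along p a (c *\<^sub>R x) \<le> c * linear_along p a x"
    using c by (simp add: field_simps)
qed

text \<open>Subadditivity mixes two members \<open>q\<close> and \<open>r\<close>; in a chain one of
  them lies below the other and serves for both. The bound \<open>q \<le> p\<close> gives the common
  lower bound \<open>- p (- x)\<close>, so the infima are finite.\<close>

lemma sublinear_INF_chain:
  assumes "C \<noteq> {}" and sub: "\<And>q. q \<in> C \<Longrightarrow> sublinear q"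
    and le: "\<And>q. q \<in> C \<Longrightarrow> q \<le> p"
    and chain: "\<And>q r. q \<in> C \<Longrightarrow> r \<in> C \<Longrightarrow> q \<le> r \<or> r \<le> q"
  shows "sublinear (\<lambda>x. INF q\<in>C. q x)" "\<And>q x. q \<in> C \<Longrightarrow> (INF q\<in>C. q x) \<le> q x"
proof -
  have "- p (- x) \<le> q x" if "q \<in> C" for q x
    using sublinear_neg_le[OF sub[OF that], of x] le_funD[OF le[OF that], of "- x"] by simp
  then have "bdd_below ((\<lambda>q. q x) ` C)" for x
    by (intro bdd_belowI2[where m = "- p (- x)"]) auto
  then show lower: "(INF q\<in>C. q x) \<le> q x" if "q \<in> C" for q x
    using that by (intro cINF_lower) auto
  show "sublinear (\<lambda>x. INF q\<in>C. q x)"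
    unfolding sublinear_def
  proof (intro conjI allI impI)
    fix x y
    have *: "(INF q\<in>C. q (x + y)) \<le> q x + r y" if qr: "q \<in> C" "r \<in> C" for q r
    proof -
      obtain s where s: "s \<in> C" "s \<le> q" "s \<le> r"
        using chain[OF qr] qr by (metis order.refl)
      have "(INF q\<in>C. q (x + y)) \<le> s x + s y"
        using lower[OF s(1), of "x + y"] sublinear_add[OF sub[OF s(1)], of x y] by simp
      then show ?thesis
        using le_funD[OF s(2), of x] le_funD[OF s(3), of y] by simp
    qed
    have "(INF q\<in>C. q (x + y)) - q x \<le> (INF r\<in>C. r y)" if "q \<in> C" for q
      using *[OF that] by (intro cINF_greatest assms(1)) (simp add: algebra_simps)
    then have "(INF q\<in>C. q (x + y)) - (INF r\<in>C. r y) \<le> (INF q\<in>C. q x)"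
      by (intro cINF_greatest assms(1)) (simp add: algebra_simps)
    then show "(INF q\<in>C. q (x + y)) \<le> (INF q\<in>C. q x) + (INF q\<in>C. q y)"
      by simp
  next
    fix c :: real and x
    assume c: "0 < c"
    have "(INF q\<in>C. q (c *\<^sub>R x)) / c \<le> (INF q\<in>C. q x)"
    proof (intro cINF_greatest assms(1))
      fix q
      assume q: "q \<in> C"
      have "(INF q\<in>C. q (c *\<^sub>R x)) \<le> c * q x"
        using lower[OF q, of "c *\<^sub>R x"] sublinear_scale[OF sub[OF q], of c x] c by simp
      then show "(INF q\<in>C. q (c *\<^sub>R x)) / c \<le> q x"
        using c by (simp add: field_simps)
    qed
    then show "(INF q\<in>C. q (c *\<^sub>R x)) \<le> c * (INF q\<in>C. q x)"
      using c by (simp add: field_simps)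
  qed
qed

text \<open>A minimal sublinear functional \<open>q\<close> agrees with \<open>linear_along q a\<close> for every \<open>a\<close>,
  which forces it to be superadditive and hence linear.\<close>
lemma sublinear_dominates_linear:
  fixes p :: "'v::real_vector \<Rightarrow> real"
  assumes p: "sublinear p"
  obtains L where "linear L" "L \<le> p"
proof -
  define S where "S = {q. sublinear q \<and> q \<le> p}"
  \<comment> \<open>Zorn's lemma for the reversed order: a maximal element is a minimal sublinear
    functional below \<open>p\<close>.\<close>
  have "\<exists>q\<in>S. \<forall>r\<in>S. r \<le> q \<longrightarrow> r = q"
  proof (rule predicate_Zorn[where P = "\<lambda>a b. b \<le> a"])
    show "partial_order_on S (relation_of (\<lambda>a b. b \<le> a) S)"
      by (rule partial_order_on_relation_ofI) auto
  next
    fix C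
    assume C: "C \<in> Chains (relation_of (\<lambda>a b. b \<le> a) S)"
    then have CS: "C \<subseteq> S" and chain: "\<And>q r. q \<in> C \<Longrightarrow> r \<in> C \<Longrightarrow> q \<le> r \<or> r \<le> q"
      unfolding Chains_def relation_of_def by blast+
    show "\<exists>u\<in>S. \<forall>a\<in>C. u \<le> a"
    proof (cases "C = {}")
      case True
      then show ?thesis using p unfolding S_def by auto
    next
      case False
      have inf: "sublinear (\<lambda>x. INF q\<in>C. q x)" "\<And>q x. q \<in> C \<Longrightarrow> (INF q\<in>C. q x) \<le> q x"
        using sublinear_INF_chain[OF False, of p] CS chain unfolding S_def by blast+
      moreover obtain q where "q \<in> C" "q \<le> p"
        using False CS unfolding S_def by auto
      ultimately have "(\<lambda>x. INF q\<in>C. q x) \<le> p"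
        by (auto simp: le_fun_def intro: order_trans)
      with inf show ?thesis
        unfolding S_def by (intro bexI[of _ "\<lambda>x. INF q\<in>C. q x"]) (auto simp: le_fun_def)
    qed
  qed
  then obtain q where q: "sublinear q" "q \<le> p"
    and min: "\<And>r. sublinear r \<Longrightarrow> r \<le> p \<Longrightarrow> r \<le> q \<Longrightarrow> r = q"
    unfolding S_def by auto
  have along: "linear_along q a = q" for a
  proof -
    have "linear_along q a \<le> q"
      using linear_along_le_self[OF q(1)] by (simp add: le_fun_def)
    with q show ?thesis
      by (intro min sublinear_linear_along) auto
  qed
  \<comment> \<open>Since \<open>linear_along q a\<close> is \<open>q\<close>, the choice
    \<open>t = 1\<close> in \<open>linear_along_le\<close> gives
    \<open>q x + q a \<le> q (x + a)\<close>.\<close>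
  have add: "q (x + a) = q x + q a" for x a
    using linear_along_le[OF q(1), of 1 a x] sublinear_add[OF q(1), of x a] by (simp add: along)
  have neg: "q (- x) = - q x" for x
    using add[of x "- x"] sublinear_zero[OF q(1)] by simp
  have "q (c *\<^sub>R x) = c * q x" for c x
  proof (cases "c \<ge> 0")
    case True
    then show ?thesis by (rule sublinear_scale[OF q(1)])
  next
    case False
    then show ?thesis
      using sublinear_scale[OF q(1), of "- c" x] neg[of "c *\<^sub>R x"] by simp
  qed
  with add q(2) show ?thesis
    by (intro that[of q] linearI) auto
qed

text \<open>A linear functional below \<open>linear_along p a\<close>, and not merely below
  \<open>p\<close>, satisfies \<open>L (- a) \<le> - p a\<close>: take \<open>t = 1\<close>, where
  \<open>- a + a\<close> vanishes. Linearity turns this into \<open>p a \<le> L a\<close>.\<close>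

lemma Hahn_Banach_support:
  fixes p :: "'v::real_vector \<Rightarrow> real"
  assumes p: "sublinear p"
  obtains L where "linear L" "L \<le> p" "L a = p a"
proof -
  obtain L where L: "linear L" "L \<le> linear_along p a"
    using sublinear_dominates_linear[OF sublinear_linear_along[OF p]] by blast
  have "L x \<le> p x" for x
    using le_funD[OF L(2), of x] linear_along_le_self[OF p, of a x] by simp
  moreover have "L (- a) \<le> - p a"
    using le_funD[OF L(2), of "- a"] linear_along_le[OF p, of 1 a "- a"] sublinear_zero[OF p] by simp
  then have "p a \<le> L a"
    by (simp add: linear_neg[OF L(1)])
  ultimately show ?thesis
    using L(1) by (intro that[of L]) (auto simp: le_fun_def intro: antisym)
qed

text \<open>All bounded functions on a type are the bounded continuous functions on its discrete copy.\<close>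
lemma Hahn_Banach_bounded_functions:
  fixes p :: "('a \<Rightarrow> real) \<Rightarrow> real"
  assumes add: "\<And>f g. bounded (range f) \<Longrightarrow> bounded (range g) \<Longrightarrow> p (\<lambda>x. f x + g x) \<le> p f + p g"
    and scale: "\<And>c f. 0 < c \<Longrightarrow> bounded (range f) \<Longrightarrow> p (\<lambda>x. c * f x) \<le> c * p f"
    and f0: "bounded (range f0)"
  obtains L where
    "\<And>f g. bounded (range f) \<Longrightarrow> bounded (range g) \<Longrightarrow> L (\<lambda>x. f x + g x) = L f + L g"
    "\<And>c f. bounded (range f) \<Longrightarrow> L (\<lambda>x. c * f x) = c * L f"
    "\<And>f. bounded (range f) \<Longrightarrow> L f \<le> p f"
    "L f0 = p f0"
proof -
  \<comment> \<open>The type of bounded continuous functions supplies the \<open>real_vector\<close>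
    structure that the abstract lemma requires. \<open>into\<close> is meaningful for bounded
    arguments, whence the boundedness hypotheses throughout.\<close>
  define into :: "('a \<Rightarrow> real) \<Rightarrow> ('a discrete \<Rightarrow>\<^sub>C real)" where
    "into f = Bcontfun (\<lambda>x. f (of_discrete x))" for f
  define out :: "('a discrete \<Rightarrow>\<^sub>C real) \<Rightarrow> 'a \<Rightarrow> real" where
    "out F x = apply_bcontfun F (discrete x)" for F x
  have cont: "continuous_on UNIV h" for h :: "'a discrete \<Rightarrow> real"
    by (simp add: continuous_on_open_vimage open_discrete)
  have apply_into: "apply_bcontfun (into f) x = f (of_discrete x)" if "bounded (range f)" for f x
  proof -
    have "bounded (range (\<lambda>x. f (of_discrete x)))"
      by (rule bounded_subset[OF that]) auto
    then show ?thesis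
      unfolding into_def by (subst Bcontfun_inverse) (auto simp: bcontfun_def cont)
  qed
  have out_into: "out (into f) = f" if "bounded (range f)" for f
    using that by (simp add: fun_eq_iff out_def apply_into discrete_inverse)
  have bounded_out: "bounded (range (out F))" for F
    by (rule bounded_subset[of "range (apply_bcontfun F)"]) (auto simp: out_def)
  have "sublinear (\<lambda>F. p (out F))"
    unfolding sublinear_def
  proof (intro conjI allI impI)
    fix F G
    have "out (F + G) = (\<lambda>x. out F x + out G x)"
      by (simp add: out_def fun_eq_iff)
    then show "p (out (F + G)) \<le> p (out F) + p (out G)"
      using add[OF bounded_out bounded_out] by simp
  next
    fix c :: real and F
    assume c: "0 < c"
    have "out (c *\<^sub>R F) = (\<lambda>x. c * out F x)"
      by (simp add: out_def fun_eq_iff)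
    then show "p (out (c *\<^sub>R F)) \<le> c * p (out F)"
      using scale[OF c bounded_out] by simp
  qed
  then obtain L where L: "linear L" "L \<le> (\<lambda>F. p (out F))" "L (into f0) = p (out (into f0))"
    by (rule Hahn_Banach_support)
  show ?thesis
  proof (rule that[of "\<lambda>f. L (into f)"])
    fix f g :: "'a \<Rightarrow> real"
    assume f: "bounded (range f)"
    have "into (\<lambda>x. c * f x) = c *\<^sub>R into f" for c
      using f by (intro bcontfun_eqI) (simp add: apply_into bounded_scaleR_comp[of f UNIV, unfolded real_scaleR_def])
    then show "L (into (\<lambda>x. c * f x)) = c * L (into f)" for c
      by (simp add: linear_scale[OF L(1)])
    show "L (into f) \<le> p f"
      using le_funD[OF L(2), of "into f"] by (simp add: out_into f)
    assume g: "bounded (range g)"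
    have "into (\<lambda>x. f x + g x) = into f + into g"
      using f g by (intro bcontfun_eqI) (simp add: apply_into bounded_plus_comp)
    then show "L (into (\<lambda>x. f x + g x)) = L (into f) + L (into g)"
      by (simp add: linear_add[OF L(1)])
  next
    show "L (into f0) = p f0"
      using L(3) by (simp add: out_into f0)
  qed
qed

section \<open>Riesz representation\<close>

text \<open>Functions are total on the type, but \<open>nonpos\<close> inspects them on
  \<open>K\<close> alone. Together with linearity this makes \<open>L f\<close>, for bounded
  \<open>f\<close>, depend on the restriction of \<open>f\<close> to \<open>K\<close> alone.\<close>

locale positive_functional =
  fixes K :: "'a::heine_borel set" and L :: "('a \<Rightarrow> real) \<Rightarrow> real"
  assumes compact: "compact K"
    and add: "\<And>f g. bounded (range f) \<Longrightarrow> bounded (range g) \<Longrightarrow> L (\<lambda>x. f x + g x) = L f + L g"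
    and scale: "\<And>c f. bounded (range f) \<Longrightarrow> L (\<lambda>x. c * f x) = c * L f"
    and nonpos: "\<And>f. bounded (range f) \<Longrightarrow> (\<And>x. x \<in> K \<Longrightarrow> f x \<le> 0) \<Longrightarrow> L f \<le> 0"
begin

lemma bounded_scale: "bounded (range f) \<Longrightarrow> bounded (range (\<lambda>x. c * f x))"
  for f :: "'a \<Rightarrow> real"
  using bounded_scaleR_comp[of f UNIV c] by simp

lemma mono:
  assumes f: "bounded (range f)" and g: "bounded (range g)" and le: "\<And>x. x \<in> K \<Longrightarrow> f x \<le> g x"
  shows "L f \<le> L g"
proof -
  have "L (\<lambda>x. f x + (- 1) * g x) \<le> 0"
    using le by (intro nonpos bounded_plus_comp f bounded_scale g) auto
  then show ?thesis
    using add[OF f bounded_scale[OF g, of "- 1"]] scale[OF g, of "- 1"] by simp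
qed

lemma sum:
  assumes "finite J" and "\<And>j. j \<in> J \<Longrightarrow> bounded (range (f j))"
  shows "bounded (range (\<lambda>x. \<Sum>j\<in>J. f j x)) \<and> L (\<lambda>x. \<Sum>j\<in>J. f j x) = (\<Sum>j\<in>J. L (f j))"
  using assms
proof (induction J rule: finite_induct)
  case empty
  then show ?case using scale[of "\<lambda>_. 0" 0] by simp
next
  case (insert j J)
  then show ?case by (auto simp: add bounded_plus_comp)
qed

section \<open>Finitely additive content and its regular sets\<close>

definition content :: "'a set \<Rightarrow> real" where
  "content A = L (indicat_real A)"

lemma bounded_indicator: "bounded (range (indicat_real A))"
  by (rule boundedI[where B = 1]) (auto simp: indicator_def)

text \<open>The inclusion is tested inside \<open>K\<close> because \<open>L\<close> ignores values
  elsewhere. Hence open sets of the whole space can serve as outer approximations.\<close>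

lemma content_mono: "A \<inter> K \<subseteq> B \<Longrightarrow> content A \<le> content B"
  unfolding content_def by (intro mono bounded_indicator) (auto simp: indicator_def)

lemma content_Un:
  assumes "A \<inter> B = {}"
  shows "content (A \<union> B) = content A + content B"
proof -
  have "indicat_real (A \<union> B) = (\<lambda>x. indicat_real A x + indicat_real B x)"
    using assms by (auto simp: indicator_def fun_eq_iff)
  then show ?thesis
    unfolding content_def by (simp add: add bounded_indicator)
qed

lemma content_empty [simp]: "content {} = 0"
  using content_Un[of "{}" "{}"] by simp

lemma content_nonneg: "0 \<le> content A"
  using content_mono[of "{}" A] by simp

lemma content_Diff: "B \<subseteq> A \<Longrightarrow> content (A - B) = content A - content B"
  using content_Un[of B "A - B"] by (simp add: Un_absorb1)

lemma content_subadd: "content (A \<union> B) \<le> content A + content B"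
  using content_Un[of A "B - A"] content_mono[of "B - A" B] by auto

lemma content_UN_le: "finite J \<Longrightarrow> content (\<Union>j\<in>J. A j) \<le> (\<Sum>j\<in>J. content (A j))"
proof (induction J rule: finite_induct)
  case (insert j J)
  then show ?case
    using content_subadd[of "A j" "\<Union>j\<in>J. A j"] by simp
qed simp

text \<open>The analogue of Jordan measurability for \<open>content\<close>: on these sets compactness turns finite
  additivity into countable additivity.\<close>
definition regular_sets :: "'a set set" where
  "regular_sets = {A \<in> sets borel. A \<subseteq> K \<and>
     (\<forall>e>0. \<exists>C U. compact C \<and> open U \<and> C \<subseteq> A \<and> A \<subseteq> U \<and> content (U - C) < e)}"

lemma regular_setsI:
  assumes "A \<in> sets borel" "A \<subseteq> K"
    and "\<And>e. 0 < e \<Longrightarrow> \<exists>C U. compact C \<and> open U \<and> C \<subseteq> A \<and> A \<subseteq> U \<and> content (U - C) < e"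
  shows "A \<in> regular_sets"
  using assms by (simp add: regular_sets_def)

lemma regular_setsE:
  assumes "A \<in> regular_sets" "0 < e"
  obtains C U where "compact C" "open U" "C \<subseteq> A" "A \<subseteq> U" "content (U - C) < e"
  using assms unfolding regular_sets_def by blast

lemma regular_sets_subset: "A \<in> regular_sets \<Longrightarrow> A \<subseteq> K"
  and regular_sets_borel: "A \<in> regular_sets \<Longrightarrow> A \<in> sets borel"
  by (auto simp: regular_sets_def)

lemma K_borel: "K \<in> sets borel"
  using compact by (simp add: borel_compact)

text \<open>Complements exchange the two approximations: \<open>K - U\<close> is compact and
  \<open>- C\<close> is open. What \<open>- C\<close> contains outside \<open>K\<close> has no
  content.\<close>

lemma regular_sets_compl:
  assumes A: "A \<in> regular_sets"
  shows "K - A \<in> regular_sets"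
proof (rule regular_setsI)
  show "K - A \<in> sets borel"
    using K_borel regular_sets_borel[OF A] by auto
next
  fix e :: real
  assume "0 < e"
  with A obtain C U where CU: "compact C" "open U" "C \<subseteq> A" "A \<subseteq> U" "content (U - C) < e"
    by (rule regular_setsE)
  have "content (- C - (K - U)) \<le> content (U - C)"
    by (rule content_mono) auto
  then show "\<exists>C' U'. compact C' \<and> open U' \<and> C' \<subseteq> K - A \<and> K - A \<subseteq> U' \<and> content (U' - C') < e"
    using CU compact by (intro exI[of _ "K - U"] exI[of _ "- C"])
      (auto simp: compact_imp_closed open_Compl intro: compact_diff)
qed auto

lemma regular_sets_Un:
  assumes A: "A \<in> regular_sets" and B: "B \<in> regular_sets"
  shows "A \<union> B \<in> regular_sets"
proof (rule regular_setsI)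
  fix e :: real
  assume "0 < e"
  then have e: "0 < e / 2" by simp
  obtain C U where CU: "compact C" "open U" "C \<subseteq> A" "A \<subseteq> U" "content (U - C) < e / 2"
    by (rule regular_setsE[OF A e])
  obtain D V where DV: "compact D" "open V" "D \<subseteq> B" "B \<subseteq> V" "content (V - D) < e / 2"
    by (rule regular_setsE[OF B e])
  have "content (U \<union> V - (C \<union> D)) \<le> content ((U - C) \<union> (V - D))"
    by (rule content_mono) auto
  also have "\<dots> < e"
    using content_subadd[of "U - C" "V - D"] CU DV by simp
  finally show "\<exists>C' U'. compact C' \<and> open U' \<and> C' \<subseteq> A \<union> B \<and> A \<union> B \<subseteq> U' \<and> content (U' - C') < e"
    using CU DV by (intro exI[of _ "C \<union> D"] exI[of _ "U \<union> V"]) auto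
qed (use A B in \<open>auto dest: regular_sets_subset regular_sets_borel\<close>)

lemma algebra_regular_sets: "algebra K regular_sets"
  unfolding algebra_iff_Un
proof (intro conjI ballI)
  show "{} \<in> regular_sets"
    by (rule regular_setsI) (auto intro!: exI[of _ "{}"])
qed (auto dest: regular_sets_subset simp: regular_sets_compl regular_sets_Un)

sublocale algebra K regular_sets
  by (rule algebra_regular_sets)

text \<open>Approximate each \<open>A i\<close> by a compact \<open>C i\<close> with errors from a
  geometric series of sum at most \<open>e\<close>. The finite intersections of the
  \<open>C i\<close> decrease to the empty set, so by compactness one of them is already empty; from
  there on \<open>A n\<close> is covered by the errors.\<close>

lemma content_empty_continuous:
  assumes A: "range A \<subseteq> regular_sets" "decseq A" "(\<Inter>i. A i) = {}"
  shows "(\<lambda>i. content (A i)) \<longlonglongrightarrow> 0"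
proof (rule LIMSEQ_I)
  fix e :: real
  assume e: "0 < e"
  have "\<exists>C. compact C \<and> C \<subseteq> A i \<and> content (A i - C) < e * (1/2) ^ Suc i" for i
  proof -
    have "A i \<in> regular_sets" "0 < e * (1/2) ^ Suc i"
      using A(1) e by auto
    then obtain C U where CU: "compact C" "open U" "C \<subseteq> A i" "A i \<subseteq> U"
        "content (U - C) < e * (1/2) ^ Suc i"
      by (rule regular_setsE)
    have "content (A i - C) \<le> content (U - C)"
      using CU by (intro content_mono) auto
    with CU show ?thesis by fastforce
  qed
  then obtain C where C: "\<And>i. compact (C i)" "\<And>i. C i \<subseteq> A i"
      "\<And>i. content (A i - C i) < e * (1/2) ^ Suc i"
    by metis
  have "\<Inter> (range (\<lambda>n. \<Inter>i\<le>n. C i)) \<subseteq> (\<Inter>i. A i)"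
    using C(2) by blast
  then have "\<Inter> (range (\<lambda>n. \<Inter>i\<le>n. C i)) = {}"
    using A(3) by simp
  moreover have "compact (\<Inter>i\<le>n. C i)" for n
    using C(1) by (intro compact_Inter) auto
  moreover have "(\<Inter>i\<le>n. C i) \<subseteq> (\<Inter>i\<le>m. C i)" if "m \<le> n" for m n
    using that by (intro INT_anti_mono) auto
  ultimately obtain N where N: "(\<Inter>i\<le>N. C i) = {}"
    using compact_nest[of "\<lambda>n. \<Inter>i\<le>n. C i"] by blast
  have "content (A n) < e" if "N \<le> n" for n
  proof -
    \<comment> \<open>A point of \<open>A n\<close> is missed by some \<open>C i\<close> with
      \<open>i \<le> N \<le> n\<close>, and it lies in \<open>A i\<close> because \<open>A\<close>
      decreases.\<close>
    have "A n \<subseteq> (\<Union>i\<in>{..N}. A i - C i)"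
    proof
      fix x
      assume x: "x \<in> A n"
      obtain i where i: "i \<le> N" "x \<notin> C i"
        using N by blast
      then have "x \<in> A i"
        using x decseqD[OF A(2), of i n] that by auto
      with i show "x \<in> (\<Union>i\<in>{..N}. A i - C i)" by auto
    qed
    then have "content (A n) \<le> content (\<Union>i\<in>{..N}. A i - C i)"
      by (intro content_mono) auto
    also have "\<dots> \<le> (\<Sum>i\<in>{..N}. content (A i - C i))"
      by (rule content_UN_le) simp
    also have "\<dots> \<le> (\<Sum>i\<in>{..N}. e * (1/2) ^ Suc i)"
      using C(3) by (intro sum_mono less_imp_le)
    also have "\<dots> = e * (\<Sum>i<Suc N. (1/2) ^ Suc i)"
      by (simp add: sum_distrib_left lessThan_Suc_atMost)
    also have "(\<Sum>i<Suc N. (1/2 :: real) ^ Suc i) = 1 - (1/2) ^ Suc N"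
      by (induction N) (auto simp: field_simps)
    also have "e * \<dots> < e"
      using e by (simp add: algebra_simps)
    finally show ?thesis .
  qed
  then show "\<exists>N. \<forall>n\<ge>N. norm (content (A n) - 0) < e"
    using content_nonneg by auto
qed

text \<open>The content of the sublevel set is monotone in \<open>t\<close>, so it has countably
  many discontinuities. At a continuity point the set is squeezed between a compact sublevel set
  slightly below \<open>t\<close> and an open one slightly above, with a small gap in
  content.\<close>

lemma sublevel_regular:
  fixes f :: "'a \<Rightarrow> real"
  assumes f: "continuous_on K f"
  shows "countable {t. {x\<in>K. f x < t} \<notin> regular_sets}"
proof -
  define g where "g t = content {x\<in>K. f x < t}" for t
  have "mono g"
    unfolding g_def by (intro monoI content_mono) auto
  then have "countable {t. \<not> isCont g t}"
    by (rule mono_ctble_discont)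
  moreover have "{x\<in>K. f x < t} \<in> regular_sets" if cont: "isCont g t" for t
  proof (rule regular_setsI)
    obtain T where T: "open T" "T \<inter> K = f -` {..<t} \<inter> K"
      using f unfolding continuous_on_open_invariant by (metis open_lessThan)
    have "{x\<in>K. f x < t} = T \<inter> K"
      using T by auto
    then show "{x\<in>K. f x < t} \<in> sets borel"
      using K_borel T(1) by auto
  next
    fix e :: real
    assume "0 < e"
    then obtain d where d: "d > 0" "\<And>s. \<bar>s - t\<bar> < d \<Longrightarrow> \<bar>g s - g t\<bar> < e / 2"
      using cont unfolding continuous_at_eps_delta dist_real_def by (metis half_gt_zero)
    define r where "r = d / 2"
    have r: "r > 0" "r < d" using d by (auto simp: r_def)
    obtain U where U: "open U" "U \<inter> K = f -` {..<t + r} \<inter> K"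
      using f unfolding continuous_on_open_invariant by (metis open_lessThan)
    define C where "C = {x\<in>K. f x \<le> t - r}"
    have "closedin (top_of_set K) (K \<inter> f -` {..t - r})"
      by (intro continuous_closedin_preimage f) auto
    then have "compact (K \<inter> f -` {..t - r})"
      using compact closedin_compact by blast
    also have "K \<inter> f -` {..t - r} = C"
      by (auto simp: C_def)
    finally have "compact C" .
    \<comment> \<open>Within \<open>K\<close> the set \<open>U\<close> is the strict sublevel set at
      \<open>t + r\<close>, and \<open>C\<close> contains the one at \<open>t - r\<close>.\<close>
    have "content (U - C) \<le> content ({x\<in>K. f x < t + r} - {x\<in>K. f x < t - r})"
      using U(2) by (intro content_mono) (auto simp: C_def)
    also have "\<dots> = g (t + r) - g (t - r)"
      unfolding g_def using r by (intro content_Diff) auto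
    also have "\<dots> < e"
      using d(2)[of "t + r"] d(2)[of "t - r"] r by (auto simp: abs_if split: if_splits)
    finally have "content (U - C) < e" .
    with \<open>compact C\<close> U r show "\<exists>C U. compact C \<and> open U \<and> C \<subseteq> {x\<in>K. f x < t} \<and> {x\<in>K. f x < t} \<subseteq> U \<and>
        content (U - C) < e"
      by (intro exI[of _ C] exI[of _ U]) (auto simp: C_def)
  qed auto
  ultimately show ?thesis
    by (rule_tac countable_subset) auto
qed

text \<open>For the nontrivial inclusion, a nonempty closed set is, within \<open>K\<close>, a
  countable intersection of sublevel sets of the distance to it, at levels tending to 0 that can be
  chosen regular.\<close>

lemma sigma_sets_regular: "sigma_sets K regular_sets = sets (restrict_space borel K)"
proof
  have "regular_sets \<subseteq> sets (restrict_space borel K)"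
    using K_borel by (auto simp: sets_restrict_space_iff regular_sets_def)
  then show "sigma_sets K regular_sets \<subseteq> sets (restrict_space borel K)"
    using sets.sigma_sets_subset[of regular_sets "restrict_space borel K"]
    by (simp add: space_restrict_space)
next
  have closed: "K \<inter> F \<in> sigma_sets K regular_sets" if F: "closed F" for F
  proof (cases "F = {}")
    case True
    then show ?thesis by (simp add: sigma_sets.Empty)
  next
    case False
    have cont: "continuous_on K (\<lambda>x. infdist x F)"
      by (intro continuous_intros)
    have "\<exists>t. 0 < t \<and> t < 1 / Suc n \<and> {x\<in>K. infdist x F < t} \<in> regular_sets" for n
    proof -
      \<comment> \<open>An open interval is uncountable, while the exceptional levels are
        countable.\<close>
      have "\<not> {0<..<1 / Suc n} \<subseteq> {t. {x\<in>K. infdist x F < t} \<notin> regular_sets}"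
        using uncountable_open_interval[of 0 "1 / Suc n"] sublevel_regular[OF cont]
          countable_subset by fastforce
      then show ?thesis by auto
    qed
    then obtain t where t: "\<And>n. 0 < t n" "\<And>n. t n < 1 / Suc n"
        "\<And>n. {x\<in>K. infdist x F < t n} \<in> regular_sets"
      by metis
    have "K \<inter> F = (\<Inter>n. {x\<in>K. infdist x F < t n})"
    proof (intro equalityI subsetI)
      fix x
      assume x: "x \<in> (\<Inter>n. {x\<in>K. infdist x F < t n})"
      have "infdist x F < 1 / Suc n" for n
        using x t(2)[of n] by (auto intro: less_trans)
      then have "infdist x F \<le> 0"
        by (meson nat_approx_posE not_le order.asym)
      then have "infdist x F = 0"
        using infdist_nonneg[of x F] by simp
      then show "x \<in> K \<inter> F"
        using x in_closed_iff_infdist_zero[OF F False] by auto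
    qed (use t(1) in auto)
    also have "\<dots> \<in> sigma_sets K regular_sets"
      using t(3) regular_sets_subset by (intro sigma_sets_Inter) auto
    finally show ?thesis .
  qed
  have "sets (restrict_space borel K) = (\<inter>) K ` sigma_sets UNIV {F. closed F}"
    by (simp add: sets_restrict_space borel_eq_closed sets_measure_of)
  also have "\<dots> = sigma_sets K ((\<inter>) K ` {F. closed F})"
    using compact by (intro sigma_sets_Int) (auto simp: compact_imp_closed)
  also have "\<dots> \<subseteq> sigma_sets K regular_sets"
    using closed by (intro sigma_sets_mono) auto
  finally show "sets (restrict_space borel K) \<subseteq> sigma_sets K regular_sets" .
qed

text \<open>Caratheodory's theorem for a finite content: continuity at the empty set supplies
  countable additivity.\<close>

lemma content_extension:
  obtains M where "sets M = sets (restrict_space borel K)"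
    "\<And>A. A \<in> regular_sets \<Longrightarrow> emeasure M A = ennreal (content A)"
proof -
  have "\<exists>\<mu>. (\<forall>A\<in>regular_sets. \<mu> A = ennreal (content A)) \<and>
      measure_space K (sigma_sets K regular_sets) \<mu>"
  proof (rule caratheodory_empty_continuous)
    show "positive regular_sets (\<lambda>A. ennreal (content A))"
      by (simp add: positive_def)
    show "additive regular_sets (\<lambda>A. ennreal (content A))"
      by (simp add: additive_def content_Un content_nonneg ennreal_plus)
    fix A :: "nat \<Rightarrow> 'a set"
    assume "range A \<subseteq> regular_sets" "decseq A" "(\<Inter>i. A i) = {}"
    from tendsto_ennrealI[OF content_empty_continuous[OF this]]
    show "(\<lambda>i. ennreal (content (A i))) \<longlonglongrightarrow> 0"
      by simp
  qed simp
  then obtain \<mu> where \<mu>: "\<And>A. A \<in> regular_sets \<Longrightarrow> \<mu> A = ennreal (content A)"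
      "measure_space K (sigma_sets K regular_sets) \<mu>"
    by blast
  have rs: "regular_sets \<subseteq> Pow K"
    using regular_sets_subset by auto
  have "emeasure (measure_of K regular_sets \<mu>) A = ennreal (content A)" if "A \<in> regular_sets" for A
  proof -
    have "emeasure (measure_of K regular_sets \<mu>) A = \<mu> A"
      using \<mu>(2) that rs by (intro emeasure_measure_of[OF refl])
        (auto simp: measure_space_def)
    then show ?thesis using \<mu>(1)[OF that] by simp
  qed
  then show ?thesis
    using rs by (intro that[of "measure_of K regular_sets \<mu>"]) (simp_all add: sigma_sets_regular)
qed

text \<open>Countably many levels \<open>t\<close> are excluded, so some grid \<open>t + e * \<int>\<close> consists of levels
  whose sublevel sets are regular; \<open>f\<close> is then approximated by a step function on this grid.\<close>
lemma integral_eq_functional: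
  fixes f :: "'a \<Rightarrow> real"
  assumes M: "sets M = sets (restrict_space borel K)"
    and content: "\<And>A. A \<in> regular_sets \<Longrightarrow> emeasure M A = ennreal (content A)"
    and f: "continuous_on K f"
  shows "(\<integral>x. f x \<partial>M) = L (\<lambda>x. if x \<in> K then f x else 0)"
proof -
  have space: "space M = K"
    using sets_eq_imp_space_eq[OF M] by (simp add: space_restrict_space)
  interpret finite_measure M
    by (rule finite_measureI) (simp add: space content[OF top])
  have measure: "measure M A = content A" if "A \<in> regular_sets" for A
    using content[OF that] content_nonneg by (simp add: measure_def)
  have bf: "bounded (f ` K)"
    using compact_continuous_image[OF f compact] by (rule compact_imp_bounded)
  then obtain B where B: "\<And>x. x \<in> K \<Longrightarrow> \<bar>f x\<bar> \<le> B"
    unfolding bounded_iff by auto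
  have fm: "f \<in> borel_measurable M"
    using borel_measurable_continuous_on_restrict[OF f] by (simp cong: measurable_cong_sets add: M)
  have fint: "integrable M f"
    using B fm by (intro integrable_const_bound[where B = B]) (auto simp: space)
  define F where "F x = (if x \<in> K then f x else 0)" for x
  have bF: "bounded (range F)"
    by (rule bounded_subset[of "insert 0 (f ` K)"]) (auto simp: F_def bf)
  have close: "\<bar>integral\<^sup>L M f - L F\<bar> \<le> e * content K" if e: "e > 0" for e
  proof -
    define D where "D = {t. {x\<in>K. f x < t} \<notin> regular_sets}"
    have "countable (\<Union>k::int. (\<lambda>d. d - e * k) ` D)"
      using sublevel_regular[OF f] by (auto simp: D_def)
    then obtain t where "t \<notin> (\<Union>k::int. (\<lambda>d. d - e * k) ` D)"
      using uncountable_UNIV_real by (metis UNIV_eq_I)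
    then have "t + e * k \<notin> D" for k :: int
      by (force simp: image_iff)
    then have level: "{x\<in>K. f x < t + e * k} \<in> regular_sets" for k :: int
      by (simp add: D_def)
    \<comment> \<open>Cells on which \<open>f\<close> lies between consecutive grid levels. As
      differences of regular sublevel sets they belong to the algebra.\<close>
    define A where "A k = {x\<in>K. \<lfloor>(f x - t) / e\<rfloor> = k}" for k :: int
    have "A k = {x\<in>K. f x < t + e * of_int (k + 1)} - {x\<in>K. f x < t + e * of_int k}" for k
      using e by (auto simp: A_def floor_eq_iff field_simps)
    then have A: "A k \<in> regular_sets" for k
      using Diff[OF level[of "k + 1"] level[of k]] by simp
    then have AM: "A k \<in> sets M" for k
      using K_borel regular_sets_subset regular_sets_borel by (simp add: M sets_restrict_space_iff)
    \<comment> \<open>As \<open>\<bar>f x\<bar> \<le> B\<close> on \<open>K\<close>, finitely many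
      cells cover \<open>K\<close>; there \<open>s\<close> is \<open>f\<close> rounded down to the
      grid.\<close>
    define J where "J = {\<lfloor>(- B - t) / e\<rfloor>..\<lfloor>(B - t) / e\<rfloor>}"
    define s where "s x = (\<Sum>k\<in>J. (t + e * k) * indicat_real (A k) x)" for x
    have s: "s x = t + e * \<lfloor>(f x - t) / e\<rfloor>" if x: "x \<in> K" for x
    proof -
      have "- B \<le> f x" "f x \<le> B" using B[OF x] by auto
      then have "\<lfloor>(f x - t) / e\<rfloor> \<in> J"
        using e unfolding J_def by (auto intro!: floor_mono divide_right_mono)
      then have "s x = (\<Sum>k\<in>{\<lfloor>(f x - t) / e\<rfloor>}. (t + e * k) * indicat_real (A k) x)"
        unfolding s_def by (intro sum.mono_neutral_right) (auto simp: J_def A_def)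
      then show ?thesis using x by (simp add: A_def)
    qed
    have s_le: "s x \<le> f x" "f x \<le> s x + e" if x: "x \<in> K" for x
    proof -
      have "e * \<lfloor>(f x - t) / e\<rfloor> \<le> e * ((f x - t) / e)" "e * ((f x - t) / e) \<le> e * (\<lfloor>(f x - t) / e\<rfloor> + 1)"
        using e by (intro mult_left_mono, linarith, simp)+
      then show "s x \<le> f x" "f x \<le> s x + e"
        using e s[OF x] by (simp_all add: distrib_left)
    qed
    have bs: "bounded (range s)" and Ls: "L s = (\<Sum>k\<in>J. (t + e * k) * content (A k))"
      using sum[of J "\<lambda>k x. (t + e * k) * indicat_real (A k) x"]
      by (auto simp: J_def s_def[abs_def] scale bounded_scale bounded_indicator content_def)
    have sint: "integrable M s"
      unfolding s_def[abs_def] using AM by (intro Bochner_Integration.integrable_sum integrable_mult_right) (auto simp: emeasure_eq_measure)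
    have "integral\<^sup>L M s = (\<Sum>k\<in>J. (t + e * k) * content (A k))"
      unfolding s_def[abs_def] using AM measure[OF A] 
      by (subst Bochner_Integration.integral_sum) (auto simp: emeasure_eq_measure)
    then have eq: "integral\<^sup>L M s = L s" using Ls by simp
    \<comment> \<open>Both the integral of \<open>f\<close> and \<open>L F\<close> lie between
      \<open>L s\<close> and \<open>L s + e * content K\<close>.\<close>
    have "integral\<^sup>L M s \<le> integral\<^sup>L M f"
      using s_le sint fint by (intro integral_mono) (auto simp: space)
    moreover have "integral\<^sup>L M f \<le> (\<integral>x. s x + e \<partial>M)"
      using s_le sint fint by (intro integral_mono) (auto simp: space)
    then have "integral\<^sup>L M f \<le> integral\<^sup>L M s + e * content K"
      using sint by (simp add: measure[OF top] space mult.commute)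
    moreover have "L s \<le> L F"
      using s_le by (intro mono bs bF) (auto simp: F_def)
    moreover have "L F \<le> L (\<lambda>x. s x + e * indicat_real K x)"
      using s_le by (intro mono bs bF bounded_plus_comp bounded_scale bounded_indicator) (auto simp: F_def)
    then have "L F \<le> L s + e * content K"
      by (simp add: add scale bs bounded_scale bounded_indicator content_def)
    ultimately show ?thesis
      using eq by linarith
  qed
  have "\<bar>integral\<^sup>L M f - L F\<bar> \<le> 0"
  proof (rule field_le_epsilon)
    fix e :: real
    assume e: "e > 0"
    \<comment> \<open>The summand 1 keeps the divisor positive when \<open>content K\<close> is
      0.\<close>
    have c: "content K + 1 > 0" using content_nonneg[of K] by simp
    have "\<bar>integral\<^sup>L M f - L F\<bar> \<le> e / (content K + 1) * content K"
      using e c by (intro close) simp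
    also have "\<dots> \<le> e"
      using e c by (simp add: field_simps)
    finally show "\<bar>integral\<^sup>L M f - L F\<bar> \<le> 0 + e" by simp
  qed
  then show ?thesis
    by (simp add: F_def[abs_def])
qed

text \<open>The mass of \<open>K\<close> is recorded separately, because the Bochner integral of a
  constant does not distinguish infinite mass from zero mass.\<close>

lemma Riesz_representation:
  obtains M where "sets M = sets (restrict_space borel K)"
    "\<And>f. continuous_on K f \<Longrightarrow> (\<integral>x. f x \<partial>M) = L (\<lambda>x. if x \<in> K then f x else 0)"
    "emeasure M K = ennreal (L (indicat_real K))"
proof -
  obtain M where M: "sets M = sets (restrict_space borel K)"
      "\<And>A. A \<in> regular_sets \<Longrightarrow> emeasure M A = ennreal (content A)"
    using content_extension by blast
  show ?thesis
    using M integral_eq_functional[OF M] M(2)[OF top] by (intro that[of M]) (auto simp: content_def)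
qed

end

section \<open>Duality\<close>

lemma space_eq_of_sets_restrict_borel: "sets M = sets (restrict_space borel A) \<Longrightarrow> space M = A"
  by (metis sets_eq_imp_space_eq space_restrict_space space_borel Int_UNIV_right)

lemma measurable_continuous_restrict_borel:
  assumes M: "sets M = sets (restrict_space borel A)" and g: "continuous_on A g" "g ` A \<subseteq> B"
  shows "g \<in> M \<rightarrow>\<^sub>M restrict_space borel B"
proof -
  have "g \<in> restrict_space borel A \<rightarrow>\<^sub>M restrict_space borel B"
    using g by (intro measurable_restrict_space2 borel_measurable_continuous_on_restrict)
      (auto simp: space_restrict_space)
  then show ?thesis
    by (simp add: M cong: measurable_cong_sets)
qed

lemma borel_measurable_continuous_restrict:
  assumes M: "sets M = sets (restrict_space borel A)" and g: "continuous_on A g"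
  shows "g \<in> borel_measurable M"
  using borel_measurable_continuous_on_restrict[OF g] by (simp add: M cong: measurable_cong_sets)

lemma integrable_continuous_on_compact:
  fixes f :: "'a::topological_space \<Rightarrow> 'b::{banach, second_countable_topology}"
  assumes "finite_measure M" and M: "sets M = sets (restrict_space borel K)"
    and K: "compact K" and f: "continuous_on K f"
  shows "integrable M f"
proof -
  interpret finite_measure M by fact
  obtain B where "\<And>x. x \<in> K \<Longrightarrow> norm (f x) \<le> B"
    using compact_imp_bounded[OF compact_continuous_image[OF f K]] unfolding bounded_iff by auto
  then show ?thesis
    using borel_measurable_continuous_restrict[OF M f] space_eq_of_sets_restrict_borel[OF M]
    by (intro integrable_const_bound[where B = B]) auto
qed

text \<open>The relatively closed sets form an intersection-stable generator, and indicators of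
  closed sets are pointwise limits of continuous functions with values in the unit interval;
  dominated convergence transfers the equality of integrals.\<close>

lemma measure_eqI_continuous:
  fixes M N :: "'a::metric_space measure"
  assumes fin: "finite_measure M" "finite_measure N"
    and M: "sets M = sets (restrict_space borel K)" and N: "sets N = sets (restrict_space borel K)"
    and K: "closed K"
    and eq: "\<And>f :: 'a \<Rightarrow> real. continuous_on K f \<Longrightarrow> (\<integral>x. f x \<partial>M) = (\<integral>x. f x \<partial>N)"
  shows "M = N"
proof (rule measure_eqI_generator_eq)
  let ?E = "(\<inter>) K ` {F. closed F}"
  show "Int_stable ?E"
  proof (rule Int_stableI)
    fix a b
    assume "a \<in> ?E" "b \<in> ?E"
    then obtain F G where "a = K \<inter> F" "b = K \<inter> G" "closed F" "closed G" by auto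
    then show "a \<inter> b \<in> ?E"
      by (intro image_eqI[of _ _ "F \<inter> G"]) auto
  qed
  have "sets (restrict_space borel K) = (\<inter>) K ` sigma_sets UNIV {F. closed F}"
    by (simp add: sets_restrict_space borel_eq_closed sets_measure_of)
  also have "\<dots> = sigma_sets K ?E"
    using K by (intro sigma_sets_Int) auto
  finally show "sets M = sigma_sets K ?E" "sets N = sigma_sets K ?E"
    using M N by auto
  show "range (\<lambda>_::nat. K) \<subseteq> ?E"
    by (auto intro!: image_eqI[of _ _ UNIV])
  show "emeasure M K \<noteq> \<infinity>"
    using finite_measure.emeasure_finite[OF fin(1)] by simp
  fix X
  assume "X \<in> ?E"
  then obtain F where X: "X = K \<inter> F" and F: "closed F" by auto
  show "emeasure M X = emeasure N X"
  proof (cases "F = {}")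
    case True
    then show ?thesis using X by simp
  next
    case False
    \<comment> \<open>Tents of slope \<open>n\<close> around \<open>F\<close>. For empty
      \<open>F\<close> they would be constantly 1, since \<open>infdist\<close> is then 0 by
      convention; hence the case distinction.\<close>
    define f where "f n x = max 0 (1 - real n * infdist x F)" for n x
    have cont: "continuous_on K (f n)" for n
      unfolding f_def by (intro continuous_intros)
    have lim: "(\<lambda>n. f n x) \<longlonglongrightarrow> indicat_real F x" for x
    proof (cases "x \<in> F")
      case True
      then show ?thesis by (simp add: f_def)
    next
      case x: False
      then have "infdist x F > 0"
        using in_closed_iff_infdist_zero[OF F False] infdist_nonneg[of x F] by fastforce
      then obtain n0 where n0: "1 < real n0 * infdist x F"
        using reals_Archimedean3 by blast
      have "f n x = 0" if "n0 \<le> n" for n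
      proof -
        have "real n0 * infdist x F \<le> real n * infdist x F"
          using that infdist_nonneg[of x F] by (intro mult_right_mono) auto
        with n0 show ?thesis by (simp add: f_def)
      qed
      then have "eventually (\<lambda>n. f n x = indicat_real F x) sequentially"
        using x by (auto simp: eventually_sequentially)
      then show ?thesis by (rule tendsto_eventually)
    qed
    have conv: "(\<lambda>n. \<integral>x. f n x \<partial>P) \<longlonglongrightarrow> measure P X"
      if fin: "finite_measure P" and P: "sets P = sets (restrict_space borel K)" for P
    proof -
      interpret finite_measure P by fact
      have space: "space P = K" by (rule space_eq_of_sets_restrict_borel[OF P])
      have X_sets: "X \<in> sets P"
        using F unfolding P X sets_restrict_space by auto
      have "(\<lambda>n. \<integral>x. f n x \<partial>P) \<longlonglongrightarrow> (\<integral>x. indicat_real X x \<partial>P)"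
      proof (rule integral_dominated_convergence[where w = "\<lambda>_. 1"])
        show "AE x in P. (\<lambda>n. f n x) \<longlonglongrightarrow> indicat_real X x"
          using lim by (intro AE_I2) (auto simp: space X indicator_def)
        show "AE x in P. norm (f n x) \<le> 1" for n
          by (intro AE_I2) (auto simp: f_def infdist_nonneg)
      qed (use X_sets borel_measurable_continuous_restrict[OF P cont] in auto)
      then show ?thesis using X_sets by simp
    qed
    have "measure M X = measure N X"
      using conv[OF fin(1) M] conv[OF fin(2) N] eq[OF cont] by (auto intro: LIMSEQ_unique)
    then show ?thesis
      using fin by (simp add: finite_measure.emeasure_eq_measure)
  qed
qed auto

lemma borel_prob_onD:
  assumes "borel_prob_on K M"
  shows "prob_space M" "finite_measure M" "sets M = sets (restrict_space borel K)" "space M = K"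
  using assms prob_space.finite_measure space_eq_of_sets_restrict_borel
  unfolding borel_prob_on_def by auto

section \<open>Couplings in \<open>MI\<close> and weak duality\<close>

lemma MI_D:
  assumes "\<theta> \<in> MI K1 K2 K3 \<mu> \<nu>"
  shows "borel_prob_on ((K1 \<times> K2) \<times> K3) \<theta>"
    "distr \<theta> (restrict_space borel (K1 \<times> K2)) fst = \<nu>"
    "distr \<theta> (restrict_space borel K3) snd = \<mu>"
    "\<And>v. continuous_on K3 v \<Longrightarrow> (\<integral>z. v (snd z) \<bullet> fst (fst z) \<partial>\<theta>) = 0"
  using assms unfolding MI_def by auto

lemma MI_measurable:
  assumes "\<theta> \<in> MI K1 K2 K3 \<mu> \<nu>"
  shows "fst \<in> \<theta> \<rightarrow>\<^sub>M restrict_space borel (K1 \<times> K2)" "snd \<in> \<theta> \<rightarrow>\<^sub>M restrict_space borel K3"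
  by (rule measurable_continuous_restrict_borel[OF borel_prob_onD(3)[OF MI_D(1)[OF assms]]];
      auto intro: continuous_on_fst continuous_on_snd continuous_on_id)+

lemma MI_integral_marginals:
  fixes g :: "_ \<Rightarrow> 'b::{banach, second_countable_topology}"
  assumes \<theta>: "\<theta> \<in> MI K1 K2 K3 \<mu> \<nu>"
  shows "integrable \<nu> f \<Longrightarrow> integrable \<theta> (\<lambda>z. f (fst z) :: real)"
    "integrable \<nu> f \<Longrightarrow> (\<integral>z. f (fst z) \<partial>\<theta>) = (\<integral>z. f z \<partial>\<nu>)"
    "integrable \<mu> g \<Longrightarrow> integrable \<theta> (\<lambda>z. g (snd z))"
    "integrable \<mu> g \<Longrightarrow> (\<integral>z. g (snd z) \<partial>\<theta>) = (\<integral>u. g u \<partial>\<mu>)"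
proof -
  note m = MI_measurable[OF \<theta>]
  { assume "integrable \<nu> f"
    then have f: "integrable (distr \<theta> (restrict_space borel (K1 \<times> K2)) fst) f"
      by (simp add: MI_D(2)[OF \<theta>])
    then have fm: "f \<in> borel_measurable (restrict_space borel (K1 \<times> K2))" by auto
    show "integrable \<theta> (\<lambda>z. f (fst z))"
      using f integrable_distr_eq[OF m(1) fm] by simp
    show "(\<integral>z. f (fst z) \<partial>\<theta>) = (\<integral>z. f z \<partial>\<nu>)"
      using integral_distr[OF m(1) fm] by (simp add: MI_D(2)[OF \<theta>]) }
  { assume "integrable \<mu> g"
    then have g: "integrable (distr \<theta> (restrict_space borel K3) snd) g"
      by (simp add: MI_D(3)[OF \<theta>])
    then have gm: "g \<in> borel_measurable (restrict_space borel K3)" by auto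
    show "integrable \<theta> (\<lambda>z. g (snd z))"
      using g integrable_distr_eq[OF m(2) gm] by simp
    show "(\<integral>z. g (snd z) \<partial>\<theta>) = (\<integral>u. g u \<partial>\<mu>)"
      using integral_distr[OF m(2) gm] by (simp add: MI_D(3)[OF \<theta>]) }
qed

text \<open>Continuous test functions determine measures, so the orthogonality relation extends from
  continuous to integrable functions by comparing the \<open>u\<close>-marginals of the nonnegative
  densities \<open>x\<^sub>i + c\<close> and \<open>c\<close>.\<close>
lemma MI_orthogonal_component:
  fixes K1 :: "(real^'k) set" and K2 K3 :: "(real^'d) set"
  assumes K: "compact K1" "compact K2" "compact K3" and \<theta>: "\<theta> \<in> MI K1 K2 K3 \<mu> \<nu>"
    and g: "integrable \<mu> (g :: real^'d \<Rightarrow> real)"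
  shows "integrable \<theta> (\<lambda>z. g (snd z) * fst (fst z) $ i)"
    "(\<integral>z. g (snd z) * fst (fst z) $ i \<partial>\<theta>) = 0"
proof -
  let ?K = "(K1 \<times> K2) \<times> K3" and ?R = "restrict_space borel K3"
  note P = borel_prob_onD[OF MI_D(1)[OF \<theta>]]
  interpret prob_space \<theta> by (rule P)
  have compact: "compact ?K" using K by (intro compact_Times)
  obtain c where c: "c \<ge> 0" "\<And>z. z \<in> ?K \<Longrightarrow> \<bar>fst (fst z) $ i\<bar> \<le> c"
  proof -
    obtain B where B: "\<And>x. x \<in> K1 \<Longrightarrow> norm x \<le> B"
      using compact_imp_bounded[OF K(1)] unfolding bounded_iff by auto
    have "\<bar>fst (fst z) $ i\<bar> \<le> \<bar>B\<bar>" if "z \<in> ?K" for z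
      using B[of "fst (fst z)"] component_le_norm_cart[of "fst (fst z)" i] that by auto
    then show ?thesis
      by (intro that[of "\<bar>B\<bar>"]) auto
  qed
  define h where "h z = fst (fst z) $ i + c" for z :: "((real^'k) \<times> (real^'d)) \<times> (real^'d)"
  have h_cont: "continuous_on ?K h"
    unfolding h_def by (intro continuous_intros)
  have h_meas [measurable]: "h \<in> borel_measurable \<theta>"
    by (rule borel_measurable_continuous_restrict[OF P(3) h_cont])
  have h_nonneg: "AE z in \<theta>. 0 \<le> h z"
    using c(2) by (intro AE_I2) (force simp: P(4) h_def abs_le_iff)
  have h_int: "integrable \<theta> h"
    by (rule integrable_continuous_on_compact[OF P(2,3) compact h_cont])
  note snd_meas [measurable] = MI_measurable(2)[OF \<theta>]
  \<comment> \<open>The \<open>u\<close>-marginal of \<open>\<theta>\<close> reweighted by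
    \<open>w\<close>. Adding \<open>c\<close> makes \<open>h\<close> nonnegative, so both weights
    used below give genuine finite measures.\<close>
  define weigh where "weigh w = distr (density \<theta> (\<lambda>z. ennreal (w z))) ?R snd"
    for w :: "((real^'k) \<times> (real^'d)) \<times> (real^'d) \<Rightarrow> real"
  have finite_weigh: "finite_measure (weigh w)"
    if w: "integrable \<theta> w" "AE z in \<theta>. 0 \<le> w z" for w
  proof -
    have "emeasure (density \<theta> (\<lambda>z. ennreal (w z))) (space \<theta>) = ennreal (\<integral>z. w z \<partial>\<theta>)"
      using w by (subst emeasure_density) (auto simp: nn_integral_eq_integral intro!: nn_integral_cong_simp cong: nn_integral_cong)
    then have "finite_measure (density \<theta> (\<lambda>z. ennreal (w z)))"
      by (intro finite_measureI) auto
    then show ?thesis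
      unfolding weigh_def by (rule finite_measure.finite_measure_distr) simp
  qed
  have integral_weigh: "(\<integral>u. \<phi> u \<partial>weigh w) = (\<integral>z. w z * \<phi> (snd z) \<partial>\<theta>)"
    if w: "w \<in> borel_measurable \<theta>" "AE z in \<theta>. 0 \<le> w z" and \<phi>: "\<phi> \<in> borel_measurable ?R"
    for w and \<phi> :: "real^'d \<Rightarrow> real"
  proof -
    have "(\<lambda>z. \<phi> (snd z)) \<in> borel_measurable \<theta>"
      using measurable_compose[OF snd_meas \<phi>] .
    then show ?thesis
      unfolding weigh_def using w \<phi>
      by (subst integral_distr) (auto simp: integral_density)
  qed
  have mult_int: "integrable \<theta> (\<lambda>z. \<phi> (snd z) * fst (fst z) $ i)"
    if "integrable \<theta> (\<lambda>z. \<phi> (snd z))" for \<phi> :: "real^'d \<Rightarrow> real"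
  proof (rule Bochner_Integration.integrable_bound[of _ "\<lambda>z. c * \<phi> (snd z)"])
    have "(\<lambda>z. fst (fst z) $ i) \<in> borel_measurable \<theta>"
      by (rule borel_measurable_continuous_restrict[OF P(3)]) (intro continuous_intros)
    then show "(\<lambda>z. \<phi> (snd z) * fst (fst z) $ i) \<in> borel_measurable \<theta>"
      using that by auto
    show "AE z in \<theta>. norm (\<phi> (snd z) * fst (fst z) $ i) \<le> norm (c * \<phi> (snd z))"
    proof (rule AE_I2)
      fix z
      assume "z \<in> space \<theta>"
      then have "\<bar>\<phi> (snd z)\<bar> * \<bar>fst (fst z) $ i\<bar> \<le> \<bar>\<phi> (snd z)\<bar> * c"
        using c(2)[of z] by (intro mult_left_mono) (auto simp: P(4))
      then show "norm (\<phi> (snd z) * fst (fst z) $ i) \<le> norm (c * \<phi> (snd z))"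
        using c(1) by (simp add: abs_mult mult.commute)
    qed
  qed (use that in simp)
  have split: "(\<integral>z. h z * \<phi> (snd z) \<partial>\<theta>) =
      (\<integral>z. \<phi> (snd z) * fst (fst z) $ i \<partial>\<theta>) + (\<integral>z. c * \<phi> (snd z) \<partial>\<theta>)"
    if "integrable \<theta> (\<lambda>z. \<phi> (snd z))" for \<phi> :: "real^'d \<Rightarrow> real"
    using that mult_int[OF that]
    by (subst Bochner_Integration.integral_add[symmetric]) (auto simp: h_def algebra_simps)
  \<comment> \<open>For a continuous test function the two integrals differ by the integral of
    \<open>\<phi> u * x $ i\<close>. It vanishes by the orthogonality relation for the vector field
    \<open>\<phi>\<close> times the \<open>i\<close>-th unit vector.\<close>
  have eq: "weigh h = weigh (\<lambda>_. c)"
  proof (rule measure_eqI_continuous)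
    fix \<phi> :: "real^'d \<Rightarrow> real"
    assume \<phi>: "continuous_on K3 \<phi>"
    have "(\<lambda>z. (\<phi> (snd z) *\<^sub>R axis i 1) \<bullet> fst (fst z)) = (\<lambda>z. \<phi> (snd z) * fst (fst z :: (real^'k) \<times> (real^'d)) $ i)"
      by (simp add: inner_axis' fun_eq_iff)
    moreover have "continuous_on K3 (\<lambda>u. \<phi> u *\<^sub>R (axis i 1 :: real^'k))"
      using \<phi> by (intro continuous_intros)
    ultimately have "(\<integral>z. \<phi> (snd z) * fst (fst z) $ i \<partial>\<theta>) = 0"
      using MI_D(4)[OF \<theta>, of "\<lambda>u. \<phi> u *\<^sub>R axis i 1"] by simp
    moreover have "continuous_on ?K (\<lambda>z. \<phi> (snd z))"
      by (rule continuous_on_compose2[OF \<phi>]) (auto intro: continuous_intros)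
    then have "integrable \<theta> (\<lambda>z. \<phi> (snd z))"
      by (rule integrable_continuous_on_compact[OF P(2,3) compact])
    ultimately show "(\<integral>u. \<phi> u \<partial>weigh h) = (\<integral>u. \<phi> u \<partial>weigh (\<lambda>_. c))"
      using borel_measurable_continuous_restrict[OF refl \<phi>] h_nonneg c(1)
      by (simp add: integral_weigh split)
  qed (use finite_weigh h_int h_nonneg c(1) K(3) in \<open>auto simp: weigh_def compact_imp_closed\<close>)
  have gm: "g \<in> borel_measurable ?R"
    using g MI_D(3)[OF \<theta>] by (metis borel_measurable_integrable measurable_cong_sets sets_distr)
  have g_int: "integrable \<theta> (\<lambda>z. g (snd z))"
    by (rule MI_integral_marginals(3)[OF \<theta> g])
  show "integrable \<theta> (\<lambda>z. g (snd z) * fst (fst z) $ i)"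
    by (rule mult_int[OF g_int])
  \<comment> \<open>Equal measures integrate the merely integrable \<open>g\<close> alike; the
    \<open>c\<close> terms in \<open>split\<close> then cancel.\<close>
  have "(\<integral>z. h z * g (snd z) \<partial>\<theta>) = (\<integral>z. c * g (snd z) \<partial>\<theta>)"
    using integral_weigh[of h g] integral_weigh[of "\<lambda>_. c" g] gm h_nonneg c(1) eq by simp
  then show "(\<integral>z. g (snd z) * fst (fst z) $ i \<partial>\<theta>) = 0"
    using split[OF g_int] by simp
qed

lemma MI_orthogonal:
  fixes K1 :: "(real^'k) set" and K2 K3 :: "(real^'d) set"
  assumes K: "compact K1" "compact K2" "compact K3" and \<theta>: "\<theta> \<in> MI K1 K2 K3 \<mu> \<nu>"
    and v: "integrable \<mu> v"
  shows "integrable \<theta> (\<lambda>z. v (snd z) \<bullet> fst (fst z))" "(\<integral>z. v (snd z) \<bullet> fst (fst z) \<partial>\<theta>) = 0"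
proof -
  have v_i: "integrable \<mu> (\<lambda>u. v u $ i)" for i
    by (rule integrable_bounded_linear[OF bounded_linear_vec_nth v])
  have eq: "(\<lambda>z. v (snd z) \<bullet> fst (fst z)) = (\<lambda>z. \<Sum>i\<in>UNIV. v (snd z) $ i * fst (fst z :: (real^'k) \<times> (real^'d)) $ i)"
    by (simp add: inner_vec_def)
  show "integrable \<theta> (\<lambda>z. v (snd z) \<bullet> fst (fst z))" "(\<integral>z. v (snd z) \<bullet> fst (fst z) \<partial>\<theta>) = 0"
    unfolding eq using MI_orthogonal_component[OF K \<theta> v_i] by simp_all
qed

text \<open>Integrate the pointwise constraint against \<open>\<theta>\<close>: the marginals give
  the dual objective and the \<open>v\<close> term vanishes by \<open>MI_orthogonal\<close>. Asking
  for integrability alone covers both classes of dual competitors.\<close>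

lemma MI_weak_duality:
  fixes K1 :: "(real^'k) set" and K2 K3 :: "(real^'d) set"
  assumes K: "compact K1" "compact K2" "compact K3" and \<theta>: "\<theta> \<in> MI K1 K2 K3 \<mu> \<nu>"
    and int: "integrable \<nu> \<psi>" "integrable \<mu> \<phi>" "integrable \<mu> v"
    and feasible: "dual_feasible K1 K2 K3 \<psi> \<phi> v"
  shows "MI_obj \<theta> \<le> (\<integral>z. \<psi> z \<partial>\<nu>) + (\<integral>u. \<phi> u \<partial>\<mu>)"
proof -
  note P = borel_prob_onD[OF MI_D(1)[OF \<theta>]]
  note \<psi> = MI_integral_marginals(1,2)[OF \<theta> int(1)]
  note \<phi> = MI_integral_marginals(3,4)[OF \<theta> int(2)]
  note v = MI_orthogonal[OF K \<theta> int(3)]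
  have "continuous_on ((K1 \<times> K2) \<times> K3) (\<lambda>z. snd z \<bullet> snd (fst z))"
    by (intro continuous_intros)
  then have "integrable \<theta> (\<lambda>z. snd z \<bullet> snd (fst z))"
    using K by (intro integrable_continuous_on_compact[OF P(2,3)] compact_Times)
  then have "MI_obj \<theta> \<le> (\<integral>z. \<psi> (fst z) + \<phi> (snd z) + v (snd z) \<bullet> fst (fst z) \<partial>\<theta>)"
    unfolding MI_obj_def using \<psi>(1) \<phi>(1) v(1) feasible
    by (intro integral_mono) (auto simp: P(4) dual_feasible_def)
  also have "\<dots> = (\<integral>z. \<psi> z \<partial>\<nu>) + (\<integral>u. \<phi> u \<partial>\<mu>)"
    using \<psi> \<phi> v by simp
  finally show ?thesis .
qed

section \<open>The superhedging price as a sublinear functional\<close>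

locale centered_marginals =
  fixes K1 :: "(real^'k) set" and K2 K3 :: "(real^'d) set"
    and \<nu> :: "((real^'k) \<times> (real^'d)) measure" and \<mu> :: "(real^'d) measure"
  assumes compact_K: "compact K1" "compact K2" "compact K3"
    and \<nu>: "borel_prob_on (K1 \<times> K2) \<nu>"
    and centered: "(\<integral>x. x \<partial>(distr \<nu> (restrict_space borel K1) fst)) = 0"
    and \<mu>: "borel_prob_on K3 \<mu>"
begin

abbreviation K where "K \<equiv> (K1 \<times> K2) \<times> K3"

lemma integrable_\<nu>: "continuous_on (K1 \<times> K2) f \<Longrightarrow> integrable \<nu> f"
  for f :: "_ \<Rightarrow> 'b::{banach, second_countable_topology}"
  using compact_K by (intro integrable_continuous_on_compact[OF borel_prob_onD(2,3)[OF \<nu>]] compact_Times)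

lemma integrable_\<mu>: "continuous_on K3 f \<Longrightarrow> integrable \<mu> f"
  for f :: "_ \<Rightarrow> 'b::{banach, second_countable_topology}"
  using compact_K by (intro integrable_continuous_on_compact[OF borel_prob_onD(2,3)[OF \<mu>]])

lemma integral_fst_\<nu>: "(\<integral>z. fst z \<partial>\<nu>) = 0"
proof -
  have "fst \<in> \<nu> \<rightarrow>\<^sub>M restrict_space borel K1"
    by (intro measurable_continuous_restrict_borel[OF borel_prob_onD(3)[OF \<nu>]] continuous_intros) auto
  moreover have "(\<lambda>x. x) \<in> borel_measurable (restrict_space borel K1)"
    by (intro borel_measurable_continuous_on_restrict continuous_intros)
  ultimately show ?thesis
    using centered by (simp add: integral_distr)
qed

definition superhedge ::
  "(((real^'k) \<times> (real^'d)) \<times> (real^'d) \<Rightarrow> real) \<Rightarrow> ((real^'k) \<times> (real^'d) \<Rightarrow> real) \<Rightarrow> (real^'d \<Rightarrow> real) \<Rightarrow>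
   (real^'d \<Rightarrow> real^'k) \<Rightarrow> bool" where
  "superhedge f \<psi> \<phi> v \<longleftrightarrow> continuous_on (K1 \<times> K2) \<psi> \<and> continuous_on K3 \<phi> \<and> continuous_on K3 v \<and>
     (\<forall>z\<in>K. f z \<le> \<psi> (fst z) + \<phi> (snd z) + v (snd z) \<bullet> fst (fst z))"

definition superhedging_values :: "(((real^'k) \<times> (real^'d)) \<times> (real^'d) \<Rightarrow> real) \<Rightarrow> real set" where
  "superhedging_values f = {(\<integral>z. \<psi> z \<partial>\<nu>) + (\<integral>u. \<phi> u \<partial>\<mu>) | \<psi> \<phi> v. superhedge f \<psi> \<phi> v}"

text \<open>The sublinear functional fed to Hahn-Banach. For bounded \<open>f\<close> the infimum is
  a genuine one: constants are hedges, and \<open>superhedge_lower_bound\<close> bounds the values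
  from below.\<close>

definition superhedging_price :: "(((real^'k) \<times> (real^'d)) \<times> (real^'d) \<Rightarrow> real) \<Rightarrow> real" where
  "superhedging_price f = Inf (superhedging_values f)"

text \<open>Weak duality against the independent coupling, with the integrals carried out iteratively.\<close>
lemma superhedge_lower_bound:
  assumes s: "superhedge f \<psi> \<phi> v" and f: "\<And>z. z \<in> K \<Longrightarrow> b \<le> f z"
  shows "b \<le> (\<integral>z. \<psi> z \<partial>\<nu>) + (\<integral>u. \<phi> u \<partial>\<mu>)"
proof -
  interpret \<nu>: prob_space \<nu> by (rule borel_prob_onD[OF \<nu>])
  interpret \<mu>: prob_space \<mu> by (rule borel_prob_onD[OF \<mu>])
  have int: "integrable \<nu> \<psi>" "integrable \<mu> \<phi>" "integrable \<nu> fst"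
    using s by (auto simp: superhedge_def intro!: integrable_\<nu> integrable_\<mu> continuous_intros)
  have "b \<le> (\<integral>z. \<psi> z \<partial>\<nu>) + \<phi> u" if u: "u \<in> K3" for u
  proof -
    \<comment> \<open>With \<open>u\<close> fixed, \<open>v u\<close> is a constant vector, so its
      pairing with the centered first coordinate integrates to 0.\<close>
    have "(\<integral>z. b \<partial>\<nu>) \<le> (\<integral>z. \<psi> z + \<phi> u + v u \<bullet> fst z \<partial>\<nu>)"
    proof (rule integral_mono)
      fix z
      assume "z \<in> space \<nu>"
      then have "(z, u) \<in> K" using u borel_prob_onD(4)[OF \<nu>] by simp
      then show "b \<le> \<psi> z + \<phi> u + v u \<bullet> fst z"
        using f[of "(z, u)"] s unfolding superhedge_def by fastforce
    qed (use int in auto)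
    also have "\<dots> = (\<integral>z. \<psi> z \<partial>\<nu>) + \<phi> u + v u \<bullet> (\<integral>z. fst z \<partial>\<nu>)"
      using int by (simp add: \<nu>.prob_space)
    finally show ?thesis
      by (simp add: integral_fst_\<nu> \<nu>.prob_space)
  qed
  then have "(\<integral>u. b \<partial>\<mu>) \<le> (\<integral>u. (\<integral>z. \<psi> z \<partial>\<nu>) + \<phi> u \<partial>\<mu>)"
    using int borel_prob_onD(4)[OF \<mu>] by (intro integral_mono) auto
  then show ?thesis
    using int by (simp add: \<mu>.prob_space)
qed

lemma superhedging_price_le:
  assumes f: "bounded (range f)" and s: "superhedge f \<psi> \<phi> v"
  shows "superhedging_price f \<le> (\<integral>z. \<psi> z \<partial>\<nu>) + (\<integral>u. \<phi> u \<partial>\<mu>)"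
proof -
  obtain B where "\<And>z. \<bar>f z\<bar> \<le> B"
    using f unfolding bounded_iff by auto
  then have "- B \<le> f z" for z
    by (meson abs_le_D2 minus_le_iff)
  then have "bdd_below (superhedging_values f)"
    unfolding superhedging_values_def using superhedge_lower_bound by (intro bdd_belowI[of _ "- B"]) blast
  with s show ?thesis
    unfolding superhedging_price_def superhedging_values_def by (intro cInf_lower) auto
qed

lemma superhedging_price_greatest:
  assumes f: "bounded (range f)"
    and le: "\<And>\<psi> \<phi> v. superhedge f \<psi> \<phi> v \<Longrightarrow> b \<le> (\<integral>z. \<psi> z \<partial>\<nu>) + (\<integral>u. \<phi> u \<partial>\<mu>)"
  shows "b \<le> superhedging_price f"
proof -
  obtain B where "\<And>z. \<bar>f z\<bar> \<le> B"
    using f unfolding bounded_iff by auto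
  then have "superhedge f (\<lambda>_. B) (\<lambda>_. 0) (\<lambda>_. 0)"
    unfolding superhedge_def by (auto simp: abs_le_iff)
  then have "superhedging_values f \<noteq> {}"
    unfolding superhedging_values_def by blast
  with le show ?thesis
    unfolding superhedging_price_def by (intro cInf_greatest) (auto simp: superhedging_values_def)
qed

text \<open>Sums of hedges hedge the sum; the two infima are then taken one at a time.\<close>

lemma superhedging_price_add:
  assumes f: "bounded (range f)" and g: "bounded (range g)"
  shows "superhedging_price (\<lambda>z. f z + g z) \<le> superhedging_price f + superhedging_price g"
proof -
  have *: "superhedging_price (\<lambda>z. f z + g z) \<le>
      ((\<integral>z. \<psi> z \<partial>\<nu>) + (\<integral>u. \<phi> u \<partial>\<mu>)) + ((\<integral>z. \<psi>' z \<partial>\<nu>) + (\<integral>u. \<phi>' u \<partial>\<mu>))"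
    if s: "superhedge f \<psi> \<phi> v" "superhedge g \<psi>' \<phi>' v'" for \<psi> \<phi> v \<psi>' \<phi>' v'
  proof -
    have "superhedge (\<lambda>z. f z + g z) (\<lambda>z. \<psi> z + \<psi>' z) (\<lambda>u. \<phi> u + \<phi>' u) (\<lambda>u. v u + v' u)"
      using s unfolding superhedge_def
      by (force intro!: continuous_intros simp: inner_add_left)
    then have "superhedging_price (\<lambda>z. f z + g z) \<le> (\<integral>z. \<psi> z + \<psi>' z \<partial>\<nu>) + (\<integral>u. \<phi> u + \<phi>' u \<partial>\<mu>)"
      by (intro superhedging_price_le bounded_plus_comp f g)
    also have "(\<integral>z. \<psi> z + \<psi>' z \<partial>\<nu>) = (\<integral>z. \<psi> z \<partial>\<nu>) + (\<integral>z. \<psi>' z \<partial>\<nu>)"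
      using s by (intro Bochner_Integration.integral_add integrable_\<nu>) (auto simp: superhedge_def)
    also have "(\<integral>u. \<phi> u + \<phi>' u \<partial>\<mu>) = (\<integral>u. \<phi> u \<partial>\<mu>) + (\<integral>u. \<phi>' u \<partial>\<mu>)"
      using s by (intro Bochner_Integration.integral_add integrable_\<mu>) (auto simp: superhedge_def)
    finally show ?thesis by simp
  qed
  have "superhedging_price (\<lambda>z. f z + g z) - ((\<integral>z. \<psi> z \<partial>\<nu>) + (\<integral>u. \<phi> u \<partial>\<mu>)) \<le> superhedging_price g"
    if "superhedge f \<psi> \<phi> v" for \<psi> \<phi> v
    using *[OF that] by (intro superhedging_price_greatest g) (auto simp: algebra_simps)
  then have "superhedging_price (\<lambda>z. f z + g z) - superhedging_price g \<le> superhedging_price f"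
    by (intro superhedging_price_greatest f) (auto simp: algebra_simps)
  then show ?thesis by simp
qed

lemma superhedging_price_scale:
  assumes c: "0 < c" and f: "bounded (range f)"
  shows "superhedging_price (\<lambda>z. c * f z) \<le> c * superhedging_price f"
proof -
  have bcf: "bounded (range (\<lambda>z. c * f z))"
    using bounded_scaleR_comp[OF f, of c] by simp
  have "superhedging_price (\<lambda>z. c * f z) / c \<le> superhedging_price f"
  proof (rule superhedging_price_greatest[OF f])
    fix \<psi> \<phi> v
    assume s: "superhedge f \<psi> \<phi> v"
    have "superhedge (\<lambda>z. c * f z) (\<lambda>z. c * \<psi> z) (\<lambda>u. c * \<phi> u) (\<lambda>u. c *\<^sub>R v u)"
      unfolding superhedge_def
    proof (intro conjI ballI)
      fix z
      assume "z \<in> K"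
      then have "c * f z \<le> c * (\<psi> (fst z) + \<phi> (snd z) + v (snd z) \<bullet> fst (fst z))"
        using s c unfolding superhedge_def by (intro mult_left_mono) auto
      then show "c * f z \<le> c * \<psi> (fst z) + c * \<phi> (snd z) + c *\<^sub>R v (snd z) \<bullet> fst (fst z)"
        by (simp add: algebra_simps)
    qed (use s in \<open>auto simp: superhedge_def intro!: continuous_intros\<close>)
    then have "superhedging_price (\<lambda>z. c * f z) \<le> (\<integral>z. c * \<psi> z \<partial>\<nu>) + (\<integral>u. c * \<phi> u \<partial>\<mu>)"
      by (rule superhedging_price_le[OF bcf])
    also have "\<dots> = c * ((\<integral>z. \<psi> z \<partial>\<nu>) + (\<integral>u. \<phi> u \<partial>\<mu>))"
      by (simp add: distrib_left)
    finally show "superhedging_price (\<lambda>z. c * f z) / c \<le> (\<integral>z. \<psi> z \<partial>\<nu>) + (\<integral>u. \<phi> u \<partial>\<mu>)"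
      using c by (simp add: field_simps)
  qed
  then show ?thesis using c by (simp add: field_simps)
qed

text \<open>Continuity on \<open>K\<close> says nothing about values elsewhere, so functions are cut
  off to be bounded on the whole type, as the Hahn-Banach lemma demands.\<close>

lemma bounded_extend_zero:
  assumes "continuous_on K f"
  shows "bounded (range (\<lambda>z. if z \<in> K then f z else 0 :: real))"
proof -
  have "bounded (f ` K)"
    using assms compact_K by (intro compact_imp_bounded compact_continuous_image compact_Times)
  then show ?thesis
    by (intro bounded_subset[of "insert 0 (f ` K)" "range _"]) auto
qed

text \<open>A function \<open>\<psi> + \<phi> + v \<bullet> x\<close> with continuous ingredients is
  hedged by itself, and likewise its negative. This forces a linear \<open>L\<close> below the price
  to equal the cost on it, and the measure representing \<open>L\<close> inherits every constraint
  of \<open>MI\<close>.\<close>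

lemma optimal_MI_exists:
  assumes f0: "continuous_on K f0"
  obtains \<theta> where "\<theta> \<in> MI K1 K2 K3 \<mu> \<nu>"
    "(\<integral>z. f0 z \<partial>\<theta>) = superhedging_price (\<lambda>z. if z \<in> K then f0 z else 0)"
proof -
  obtain L where add: "\<And>f g. bounded (range f) \<Longrightarrow> bounded (range g) \<Longrightarrow> L (\<lambda>x. f x + g x) = L f + L g"
    and scale: "\<And>c f. bounded (range f) \<Longrightarrow> L (\<lambda>x. c * f x) = c * L f"
    and le: "\<And>f. bounded (range f) \<Longrightarrow> L f \<le> superhedging_price f"
    and L_f0: "L (\<lambda>z. if z \<in> K then f0 z else 0) = superhedging_price (\<lambda>z. if z \<in> K then f0 z else 0)"
    using Hahn_Banach_bounded_functions[of superhedging_price, OF superhedging_price_add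
        superhedging_price_scale bounded_extend_zero[OF f0]] by blast
  interpret positive_functional K L
  proof
    show "compact K" using compact_K by (intro compact_Times)
    fix f :: "((real^'k) \<times> (real^'d)) \<times> (real^'d) \<Rightarrow> real"
    assume f: "bounded (range f)" and "\<And>z. z \<in> K \<Longrightarrow> f z \<le> 0"
    \<comment> \<open>The zero hedge costs nothing, so domination by the price gives
      positivity.\<close>
    then have "superhedge f (\<lambda>_. 0) (\<lambda>_. 0) (\<lambda>_. 0)"
      by (auto simp: superhedge_def)
    from superhedging_price_le[OF f this] le[OF f] show "L f \<le> 0" by simp
  qed (fact add scale)+
  obtain \<theta> where sets: "sets \<theta> = sets (restrict_space borel K)"
    and rep: "\<And>f. continuous_on K f \<Longrightarrow> (\<integral>x. f x \<partial>\<theta>) = L (\<lambda>x. if x \<in> K then f x else 0)"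
    and mass: "emeasure \<theta> K = ennreal (L (indicat_real K))"
    using Riesz_representation by blast
  have space: "space \<theta> = K" by (rule space_eq_of_sets_restrict_borel[OF sets])
  have L_eq: "L (\<lambda>z. if z \<in> K then \<psi> (fst z) + \<phi> (snd z) + v (snd z) \<bullet> fst (fst z) else 0)
      = (\<integral>z. \<psi> z \<partial>\<nu>) + (\<integral>u. \<phi> u \<partial>\<mu>)"
    and hedge_cont: "continuous_on K (\<lambda>z. \<psi> (fst z) + \<phi> (snd z) + v (snd z) \<bullet> fst (fst z))"
    if cont: "continuous_on (K1 \<times> K2) \<psi>" "continuous_on K3 \<phi>" "continuous_on K3 v" for \<psi> \<phi> v
  proof -
    define f where "f z = (if z \<in> K then \<psi> (fst z) + \<phi> (snd z) + v (snd z) \<bullet> fst (fst z) else 0)" for z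
    have "continuous_on K (\<lambda>z. \<psi> (fst z))" "continuous_on K (\<lambda>z. \<phi> (snd z))" "continuous_on K (\<lambda>z. v (snd z))"
      by (rule continuous_on_compose2[OF cont(1)] continuous_on_compose2[OF cont(2)]
          continuous_on_compose2[OF cont(3)]; auto intro!: continuous_intros)+
    then show c: "continuous_on K (\<lambda>z. \<psi> (fst z) + \<phi> (snd z) + v (snd z) \<bullet> fst (fst z))"
      by (intro continuous_intros)
    have bf: "bounded (range f)"
      unfolding f_def by (rule bounded_extend_zero[OF c])
    have "superhedge f \<psi> \<phi> v"
      using cont by (auto simp: superhedge_def f_def)
    then have "L f \<le> (\<integral>z. \<psi> z \<partial>\<nu>) + (\<integral>u. \<phi> u \<partial>\<mu>)"
      using superhedging_price_le[OF bf] le[OF bf] by fastforce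
    \<comment> \<open>The negated hedge bounds \<open>L\<close> at \<open>- f\<close>, which by
      linearity is the reverse inequality at \<open>f\<close>.\<close>
    moreover have "superhedge (\<lambda>z. (- 1) * f z) (\<lambda>z. - \<psi> z) (\<lambda>u. - \<phi> u) (\<lambda>u. - v u)"
      using cont by (auto simp: superhedge_def f_def intro!: continuous_intros)
    then have "L (\<lambda>z. (- 1) * f z) \<le> (\<integral>z. - \<psi> z \<partial>\<nu>) + (\<integral>u. - \<phi> u \<partial>\<mu>)"
      using superhedging_price_le[OF bounded_scale[OF bf, of "- 1"]] le[OF bounded_scale[OF bf, of "- 1"]]
      by fastforce
    ultimately show "L (\<lambda>z. if z \<in> K then \<psi> (fst z) + \<phi> (snd z) + v (snd z) \<bullet> fst (fst z) else 0)
      = (\<integral>z. \<psi> z \<partial>\<nu>) + (\<integral>u. \<phi> u \<partial>\<mu>)"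
      using scale[OF bf, of "- 1"] unfolding f_def by simp
  qed
  have int_eq: "(\<integral>z. \<psi> (fst z) + \<phi> (snd z) + v (snd z) \<bullet> fst (fst z) \<partial>\<theta>) = (\<integral>z. \<psi> z \<partial>\<nu>) + (\<integral>u. \<phi> u \<partial>\<mu>)"
    if "continuous_on (K1 \<times> K2) \<psi>" "continuous_on K3 \<phi>" "continuous_on K3 v" for \<psi> \<phi> v
    using rep[OF hedge_cont[OF that]] L_eq[OF that] by simp
  interpret \<nu>: prob_space \<nu> by (rule borel_prob_onD[OF \<nu>])
  interpret \<mu>: prob_space \<mu> by (rule borel_prob_onD[OF \<mu>])
  \<comment> \<open>Written as the hedge with \<open>\<psi> = 1\<close>, \<open>\<phi> = 0\<close>,
    \<open>v = 0\<close>, the indicator is covered by \<open>L_eq\<close>, so the mass of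
    \<open>\<theta>\<close> is that of \<open>\<nu>\<close>.\<close>
  have "indicat_real K = (\<lambda>z. if z \<in> K then 1 + 0 + 0 \<bullet> fst (fst z) else 0)"
    by (auto simp: fun_eq_iff indicator_def)
  then have "emeasure \<theta> K = 1"
    using mass L_eq[of "\<lambda>_. 1" "\<lambda>_. 0" "\<lambda>_. 0"] by (simp add: \<nu>.prob_space)
  then interpret \<theta>: prob_space \<theta>
    by (intro prob_spaceI) (simp add: space)
  \<comment> \<open>Each constraint follows from \<open>int_eq\<close> by setting the other two
    functions to 0.\<close>
  have "\<theta> \<in> MI K1 K2 K3 \<mu> \<nu>"
    unfolding MI_def
  proof (intro CollectI conjI allI impI)
    show "borel_prob_on K \<theta>"
      using sets \<theta>.prob_space_axioms by (simp add: borel_prob_on_def)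
    have fst: "fst \<in> \<theta> \<rightarrow>\<^sub>M restrict_space borel (K1 \<times> K2)"
      by (rule measurable_continuous_restrict_borel[OF sets]) (auto intro!: continuous_intros)
    have snd: "snd \<in> \<theta> \<rightarrow>\<^sub>M restrict_space borel K3"
      by (rule measurable_continuous_restrict_borel[OF sets]) (auto intro!: continuous_intros)
    show "distr \<theta> (restrict_space borel (K1 \<times> K2)) fst = \<nu>"
    proof (rule measure_eqI_continuous)
      fix \<psi> :: "(real^'k) \<times> (real^'d) \<Rightarrow> real"
      assume \<psi>: "continuous_on (K1 \<times> K2) \<psi>"
      show "(\<integral>z. \<psi> z \<partial>distr \<theta> (restrict_space borel (K1 \<times> K2)) fst) = (\<integral>z. \<psi> z \<partial>\<nu>)"
        using int_eq[OF \<psi>, of "\<lambda>_. 0" "\<lambda>_. 0"] 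
        by (simp add: integral_distr[OF fst borel_measurable_continuous_on_restrict[OF \<psi>]])
    qed (use \<theta>.finite_measure_distr[OF fst] \<nu>.finite_measure_axioms borel_prob_onD(3)[OF \<nu>] compact_K in
        \<open>auto intro!: closed_Times simp: compact_imp_closed\<close>)
    show "distr \<theta> (restrict_space borel K3) snd = \<mu>"
    proof (rule measure_eqI_continuous)
      fix \<phi> :: "real^'d \<Rightarrow> real"
      assume \<phi>: "continuous_on K3 \<phi>"
      show "(\<integral>u. \<phi> u \<partial>distr \<theta> (restrict_space borel K3) snd) = (\<integral>u. \<phi> u \<partial>\<mu>)"
        using int_eq[OF _ \<phi>, of "\<lambda>_. 0" "\<lambda>_. 0"]
        by (simp add: integral_distr[OF snd borel_measurable_continuous_on_restrict[OF \<phi>]])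
    qed (use \<theta>.finite_measure_distr[OF snd] \<mu>.finite_measure_axioms borel_prob_onD(3)[OF \<mu>] compact_K in
        \<open>auto simp: compact_imp_closed\<close>)
    show "(\<integral>z. v (snd z) \<bullet> fst (fst z) \<partial>\<theta>) = 0" if "continuous_on K3 v" for v :: "real^'d \<Rightarrow> real^'k"
      using int_eq[of "\<lambda>_. 0" "\<lambda>_. 0" v] that by simp
  qed
  moreover have "(\<integral>z. f0 z \<partial>\<theta>) = superhedging_price (\<lambda>z. if z \<in> K then f0 z else 0)"
    using rep[OF f0] L_f0 by simp
  ultimately show ?thesis by (rule that)
qed

text \<open>The cutoff outside \<open>K\<close> does not affect the hedging condition, so the price
  of the objective is the continuous dual value.\<close>

lemma superhedge_objective_iff:
  "superhedge (\<lambda>z. if z \<in> K then snd z \<bullet> snd (fst z) else 0) \<psi> \<phi> v \<longleftrightarrow>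
    continuous_on (K1 \<times> K2) \<psi> \<and> continuous_on K3 \<phi> \<and> continuous_on K3 v \<and> dual_feasible K1 K2 K3 \<psi> \<phi> v"
  by (auto simp: superhedge_def dual_feasible_def)

end

theorem theoremC2:
  fixes K1 :: "(real^'k) set" and K2 K3 :: "(real^'d) set"
    and \<nu> :: "((real^'k) \<times> (real^'d)) measure" and \<mu> :: "(real^'d) measure"
  assumes "compact K1" and "compact K2" and "compact K3"
    and "borel_prob_on (K1 \<times> K2) \<nu>"
    and "(\<integral>x. x \<partial>(distr \<nu> (restrict_space borel K1) fst)) = 0"
    and "borel_prob_on K3 \<mu>"
  shows "\<exists>\<theta>\<in>MI K1 K2 K3 \<mu> \<nu>.
           (\<forall>\<theta>'\<in>MI K1 K2 K3 \<mu> \<nu>. MI_obj \<theta>' \<le> MI_obj \<theta>)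
         \<and> MI_obj \<theta> = Inf {(\<integral>z. \<psi> z \<partial>\<nu>) + (\<integral>u. \<phi> u \<partial>\<mu>) | \<psi> \<phi> v.
               continuous_on (K1 \<times> K2) \<psi> \<and> continuous_on K3 \<phi> \<and> continuous_on K3 v
               \<and> dual_feasible K1 K2 K3 \<psi> \<phi> v}
         \<and> MI_obj \<theta> = Inf {(\<integral>z. \<psi> z \<partial>\<nu>) + (\<integral>u. \<phi> u \<partial>\<mu>) | \<psi> \<phi> v.
               integrable \<nu> \<psi> \<and> integrable \<mu> \<phi> \<and> integrable \<mu> v
               \<and> dual_feasible K1 K2 K3 \<psi> \<phi> v}"
proof -
  interpret centered_marginals K1 K2 K3 \<nu> \<mu>
    by standard fact+
  let ?c = "\<lambda>z :: ((real^'k) \<times> (real^'d)) \<times> (real^'d). if z \<in> K then snd z \<bullet> snd (fst z) else 0"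
  define D where "D = {(\<integral>z. \<psi> z \<partial>\<nu>) + (\<integral>u. \<phi> u \<partial>\<mu>) | \<psi> \<phi> v.
               integrable \<nu> \<psi> \<and> integrable \<mu> \<phi> \<and> integrable \<mu> v
               \<and> dual_feasible K1 K2 K3 \<psi> \<phi> v}"
  have c: "continuous_on K (\<lambda>z. snd z \<bullet> snd (fst z))"
    by (intro continuous_intros)
  obtain \<theta> where \<theta>: "\<theta> \<in> MI K1 K2 K3 \<mu> \<nu>" and "MI_obj \<theta> = superhedging_price ?c"
    using optimal_MI_exists[OF c] unfolding MI_obj_def by blast
  then have opt: "MI_obj \<theta> = Inf (superhedging_values ?c)"
    by (simp only: superhedging_price_def)
  have weak: "MI_obj \<theta>' \<le> a" if "\<theta>' \<in> MI K1 K2 K3 \<mu> \<nu>" "a \<in> D" for \<theta>' a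
  proof -
    from that(2) obtain \<psi> \<phi> v where "a = (\<integral>z. \<psi> z \<partial>\<nu>) + (\<integral>u. \<phi> u \<partial>\<mu>)"
      "integrable \<nu> \<psi>" "integrable \<mu> \<phi>" "integrable \<mu> v" "dual_feasible K1 K2 K3 \<psi> \<phi> v"
      unfolding D_def by auto
    then show ?thesis
      using MI_weak_duality[OF compact_K that(1)] by simp
  qed
  have sub: "superhedging_values ?c \<subseteq> D"
    unfolding superhedging_values_def superhedge_objective_iff D_def
    by (intro Collect_mono ex_mono impI) (auto simp: integrable_\<nu> integrable_\<mu>)
  \<comment> \<open>If there were no hedge, \<open>superhedging_price_greatest\<close> would hold
    vacuously and put every real number below the price.\<close>
  have ne: "superhedging_values ?c \<noteq> {}"
  proof
    assume "superhedging_values ?c = {}"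
    then have "b \<le> superhedging_price ?c" for b
      by (intro superhedging_price_greatest bounded_extend_zero c) (auto simp: superhedging_values_def)
    then show False by (meson gt_ex not_le)
  qed
  have "MI_obj \<theta>' \<le> MI_obj \<theta>" if "\<theta>' \<in> MI K1 K2 K3 \<mu> \<nu>" for \<theta>'
    unfolding opt by (intro cInf_greatest ne weak[OF that] subsetD[OF sub])
  \<comment> \<open>Passing from continuous to integrable competitors can only lower the infimum,
    and weak duality keeps it above \<open>MI_obj \<theta>\<close>.\<close>
  moreover have "MI_obj \<theta> = Inf D"
  proof (rule antisym)
    show "MI_obj \<theta> \<le> Inf D"
    proof (rule cInf_greatest)
      show "D \<noteq> {}" using sub ne by auto
    qed (rule weak[OF \<theta>])
    have "bdd_below D"
      by (rule bdd_belowI) (rule weak[OF \<theta>])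
    then show "Inf D \<le> MI_obj \<theta>"
      unfolding opt by (intro cInf_superset_mono ne sub)
  qed
  moreover have "superhedging_values ?c = {(\<integral>z. \<psi> z \<partial>\<nu>) + (\<integral>u. \<phi> u \<partial>\<mu>) | \<psi> \<phi> v.
               continuous_on (K1 \<times> K2) \<psi> \<and> continuous_on K3 \<phi> \<and> continuous_on K3 v
               \<and> dual_feasible K1 K2 K3 \<psi> \<phi> v}"
    unfolding superhedging_values_def superhedge_objective_iff ..
  ultimately show ?thesis
    using \<theta> opt unfolding D_def by (intro bexI[of _ \<theta>]) simp_all
qed

end
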